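(* Let $\mathcal{P}_1=\{S^1\}$. Then $\mathcal{N}^{cell}(\mathcal{P}_1)$ is the class of finite solvable groups.
   Context: Cellular actions: a group $G$ acts cellularly on a CW-complex $X$ if it acts by homeomorphisms permuting the open cells, and the stabilizer of any cell fixes that cell pointwise. The class $\mathcal{N}^{cell}(\mathcal{P})$: for a class $\mathcal{P}$ of finite dimensional CW-complexes, $\mathcal{N}^{cell}(\mathcal{P})$ is the smallest class of groups containing the trivial group with the property that if a group $G$ acts cellularly on some $X\in\mathcal{P}$ such that all isotropy groups are in $\mathcal{N}^{cell}(\mathcal{P})$, then $G$ is in $\mathcal{N}^{cell}(\mathcal{P})$. The spaces listed in $\mathcal{P}_1$ are allowed to carry any CW-structure (i.e. $\mathcal{P}_1$ is the class of CW-complexes homeomorphic to the circle). *)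

theory Defs
  imports "HOL-Analysis.Analysis" "HOL-Algebra.Elementary_Groups"
    "HOL-Algebra.Group_Action" "HOL-Algebra.Solvable_Groups"
begin

text \<open>
  A CW-structure on a space is recorded by its open cells, sorted by dimension. Characteristic
  maps are only required to exist; they are not part of the structure.
\<close>

record 'x cw =
  cw_space :: "'x topology"
  cw_cells :: "nat \<Rightarrow> 'x set set"

definition all_cells :: "'x cw \<Rightarrow> 'x set set" where
  "all_cells X = (\<Union>n. cw_cells X n)"

text \<open>
  The model of \<open>\<real>\<^sup>n\<close> is \<^const>\<open>Euclidean_space\<close>: sequences vanishing from index \<open>n\<close> on. For
  \<open>n = 0\<close> both balls are a single point and the unit sphere is empty.
\<close>

definition closed_unit_ball :: "nat \<Rightarrow> (nat \<Rightarrow> real) set" where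
  "closed_unit_ball n = {x \<in> topspace (Euclidean_space n). (\<Sum>i<n. (x i)\<^sup>2) \<le> 1}"

definition open_unit_ball :: "nat \<Rightarrow> (nat \<Rightarrow> real) set" where
  "open_unit_ball n = {x \<in> topspace (Euclidean_space n). (\<Sum>i<n. (x i)\<^sup>2) < 1}"

definition unit_sphere :: "nat \<Rightarrow> (nat \<Rightarrow> real) set" where
  "unit_sphere n = {x \<in> topspace (Euclidean_space n). (\<Sum>i<n. (x i)\<^sup>2) = 1}"

text \<open>The last conjunct includes closure-finiteness: the boundary meets only finitely many cells.\<close>

definition characteristic_map ::
    "'x cw \<Rightarrow> nat \<Rightarrow> 'x set \<Rightarrow> ((nat \<Rightarrow> real) \<Rightarrow> 'x) \<Rightarrow> bool" where
  "characteristic_map X n e f \<longleftrightarrow>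
     continuous_map (subtopology (Euclidean_space n) (closed_unit_ball n)) (cw_space X) f \<and>
     homeomorphic_map (subtopology (Euclidean_space n) (open_unit_ball n))
                      (subtopology (cw_space X) e) f \<and>
     (\<exists>F. finite F \<and> F \<subseteq> (\<Union>m<n. cw_cells X m) \<and> f ` unit_sphere n \<subseteq> \<Union>F)"

text \<open>
  The disjointness condition for pairs \<open>(n, e)\<close>, together with the nonemptiness of cells (images of
  open balls), makes the dimension of a cell unique.
\<close>

definition cw_complex :: "'x cw \<Rightarrow> bool" where
  "cw_complex X \<longleftrightarrow>
     Hausdorff_space (cw_space X) \<and>
     \<Union>(all_cells X) = topspace (cw_space X) \<and>
     (\<forall>m n. \<forall>d \<in> cw_cells X m. \<forall>e \<in> cw_cells X n. (m, d) \<noteq> (n, e) \<longrightarrow> d \<inter> e = {}) \<and>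
     (\<forall>n. \<forall>e \<in> cw_cells X n. \<exists>f. characteristic_map X n e f) \<and>
     (\<forall>A \<subseteq> topspace (cw_space X).
        (\<forall>e \<in> all_cells X. closedin (cw_space X) (A \<inter> cw_space X closure_of e))
          \<longrightarrow> closedin (cw_space X) A)"

definition cellular_action ::
    "('a, 'b) monoid_scheme \<Rightarrow> 'x cw \<Rightarrow> ('a \<Rightarrow> 'x \<Rightarrow> 'x) \<Rightarrow> bool" where
  "cellular_action G X \<phi> \<longleftrightarrow>
     group_action G (topspace (cw_space X)) \<phi> \<and>
     (\<forall>g \<in> carrier G. homeomorphic_map (cw_space X) (cw_space X) (\<phi> g)) \<and>
     (\<forall>g \<in> carrier G. \<forall>e \<in> all_cells X. \<phi> g ` e \<in> all_cells X) \<and>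
     (\<forall>g \<in> carrier G. \<forall>e \<in> all_cells X. \<phi> g ` e = e \<longrightarrow> (\<forall>x \<in> e. \<phi> g x = x))"

text \<open>
  \<open>N_cell P\<close> is the class \<open>\<N>\<^sup>c\<^sup>e\<^sup>l\<^sup>l(P)\<close> restricted to groups on a fixed carrier type. Isotropy
  groups are subgroups, so the recursion never leaves that type. The trivial group is meant up
  to isomorphism. Finite-dimensionality of the members of \<open>P\<close> is left to the choice of \<open>P\<close>.
\<close>

inductive_set N_cell :: "'x cw set \<Rightarrow> 'a monoid set" for P :: "'x cw set" where
  trivial: "trivial_group G \<Longrightarrow> G \<in> N_cell P"
| action: "\<lbrakk>group G; X \<in> P; cellular_action G X \<phi>;
            \<And>x. x \<in> topspace (cw_space X) \<Longrightarrow> G\<lparr>carrier := stabilizer G \<phi> x\<rparr> \<in> N_cell P\<rbrakk>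
           \<Longrightarrow> G \<in> N_cell P"

text \<open>
  All CW-complexes homeomorphic to the circle, with points taken from the type \<^typ>\<open>complex\<close>; every
  CW-complex homeomorphic to the circle is isomorphic to one of these. They are compact, hence
  have finitely many cells, and so are automatically finite dimensional.
\<close>

definition P1 :: "complex cw set" where
  "P1 = {X. cw_complex X \<and> cw_space X homeomorphic_space top_of_set (sphere (0::complex) 1)}"

end

theory Submission
  imports Defs "HOL-Algebra.Multiplicative_Group"
begin

text \<open>
  Let \<open>G\<close> act cellularly on a circle \<open>X\<close> with finite solvable isotropy groups. The set \<open>V\<close> of vertices
  of \<open>X\<close> is finite, nonempty and invariant. As a vertex has finite orbit and finite isotropy group,
  \<open>G\<close> is finite. Go round the circle once and number the vertices \<open>p\<^sub>k\<close> by integers, periodically. A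
  homeomorphism of the circle that preserves \<open>V\<close> permutes the arcs between consecutive vertices, so
  it keeps neighbours neighbours and has the form \<open>p\<^sub>k \<mapsto> p\<^bsub>a+\<epsilon>k\<^esub>\<close> with \<open>\<epsilon> = \<plusminus>1\<close> on \<open>V\<close>
  (\<open>homeomorphic_circle_dihedral_enumeration\<close>). In other words, \<open>G\<close> acts on \<open>V\<close> through a dihedral
  group. Commutators in \<open>G\<close> therefore act on \<open>V\<close> by shifts, and commutators of those act trivially:
  the second derived subgroup of \<open>G\<close> fixes a vertex (\<open>second_derived_subset_stabilizer\<close>). It lies in a
  solvable isotropy group, so \<open>G\<close> is solvable.

  Conversely, let \<open>G\<close> be finite solvable and nontrivial. Then \<open>G\<close> has a proper normal subgroup \<open>N\<close>
  with cyclic quotient of some order \<open>m \<ge> 2\<close> (\<open>cyclic_quotient_of_imperfect\<close>). Let \<open>G\<close> act on the circle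
  through \<open>G/N\<close>, by rotations through multiples of \<open>2\<pi>/m\<close>. This action is cellular for the
  subdivision of the circle into \<open>m\<close> vertices and \<open>m\<close> arcs, and all its isotropy groups equal \<open>N\<close>,
  which is finite, solvable and smaller than \<open>G\<close>. Induction on the order of \<open>G\<close> finishes the proof.
\<close>

section \<open>Solvability from dihedral actions, and cyclic quotients\<close>

text \<open>
  The derived series of the whole group enters \<open>H\<close> after \<open>n\<close> steps,
  and from there on it stays below the derived series of \<open>H\<close>.
\<close>

lemma (in group) solvable_of_derived_subset_solvable:
  assumes H: "subgroup H G" and sol: "solvable (G\<lparr>carrier := H\<rparr>)"
    and sub: "(derived G ^^ n) (carrier G) \<subseteq> H"
  shows "solvable G"
proof -
  interpret incl: group_hom "G\<lparr>carrier := H\<rparr>" G "\<lambda>x. x"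
    using canonical_inj_is_hom[OF H] by (simp add: id_def)
  have "solvable_seq G H"
    using incl.solvable_imp_solvable_img[of H] sol by (simp add: solvable_def)
  then obtain m where m: "(derived G ^^ m) H = {\<one>}"
    using solvable_imp_trivial_derived_seq by blast
  have "(derived G ^^ m) ((derived G ^^ n) (carrier G)) \<subseteq> {\<one>}"
    using mono_exp_of_derived[OF sub, of m] m by simp
  then have "(derived G ^^ (m + n)) (carrier G) \<subseteq> {\<one>}"
    by (simp add: funpow_add)
  moreover have "\<one> \<in> (derived G ^^ (m + n)) (carrier G)"
    using exp_of_derived_is_subgroup[OF subgroup_self] by (simp add: subgroup.one_closed)
  ultimately show ?thesis
    using solvable_iff_trivial_derived_seq by blast
qed

text \<open>
  The maps \<open>p\<^sub>k \<mapsto> p\<^bsub>a+\<epsilon>k\<^esub>\<close> compose like the elements of the infinite dihedral group. The sign \<open>\<epsilon>\<close> cancels in every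
  commutator, and the shifts \<open>p\<^sub>k \<mapsto> p\<^bsub>a+k\<^esub>\<close> that remain commute with each other. The sign and the
  shift of an element need not be unique, because \<open>p\<close> may repeat values.
\<close>

lemma second_derived_subset_stabilizer:
  fixes G (structure) and p :: "int \<Rightarrow> 'x"
  assumes act: "group_action G E \<phi>" and pE: "\<And>k. p k \<in> E"
    and dihedral: "\<And>g. g \<in> carrier G \<Longrightarrow>
      \<exists>a \<epsilon>. (\<epsilon> = 1 \<or> \<epsilon> = -1) \<and> (\<forall>k. \<phi> g (p k) = p (a + \<epsilon> * k))"
  shows "(derived G ^^ 2) (carrier G) \<subseteq> stabilizer G \<phi> (p 0)"
proof -
  interpret group_action G E \<phi> by (rule act)
  interpret group G using group_hom group_hom.axioms(1) by blast
  \<comment> \<open>the elements acting as shifts, and the elements acting trivially\<close>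
  define R where "R = {g \<in> carrier G. \<exists>a. \<forall>k. \<phi> g (p k) = p (a + k)}"
  define K where "K = {g \<in> carrier G. \<forall>k. \<phi> g (p k) = p k}"
  have inv_formula: "\<phi> (inv g) (p k) = p (\<epsilon> * (k - a))"
    if g: "g \<in> carrier G" "\<epsilon> = 1 \<or> \<epsilon> = -1" "\<forall>k. \<phi> g (p k) = p (a + \<epsilon> * k)" for g a \<epsilon> k
  proof -
    have "\<phi> g (p (\<epsilon> * (k - a))) = p k" using g(2,3) by auto
    then show ?thesis using orbit_sym_aux[OF g(1) pE] by blast
  qed
  have comm_formula: "\<phi> (g \<otimes> h \<otimes> inv g \<otimes> inv h) (p k) = \<phi> g (\<phi> h (\<phi> (inv g) (\<phi> (inv h) (p k))))"
    if "g \<in> carrier G" "h \<in> carrier G" for g h k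
  proof -
    have "\<phi> (inv h) (p k) \<in> E" "\<phi> (inv g) (\<phi> (inv h) (p k)) \<in> E"
      using that pE element_image by (meson inv_closed)+
    then show ?thesis using that pE by (simp add: composition_rule)
  qed
  have one: "\<phi> \<one> (p k) = p k" for k
    using id_eq_one pE by (metis restrict_apply')
  have K: "subgroup K G"
  proof (rule subgroupI)
    show "K \<noteq> {}" using one by (auto simp: K_def)
    show "inv g \<in> K" if "g \<in> K" for g
      using that inv_formula[of g 1 0] by (auto simp: K_def)
  qed (use pE in \<open>auto simp: K_def composition_rule\<close>)
  have R: "subgroup R G"
  proof (rule subgroupI)
    show "R \<noteq> {}" using one by (auto simp: R_def intro!: exI[of _ \<one>] exI[of _ 0])
    show "inv g \<in> R" if g: "g \<in> R" for g
    proof -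
      obtain a where "g \<in> carrier G" "\<forall>k. \<phi> g (p k) = p (a + k)"
        using g by (auto simp: R_def)
      then show ?thesis
        using inv_formula[of g 1 a] by (auto simp: R_def intro!: exI[of _ "-a"])
    qed
    show "g \<otimes> h \<in> R" if gh: "g \<in> R" "h \<in> R" for g h
    proof -
      obtain a b where "g \<in> carrier G" "\<forall>k. \<phi> g (p k) = p (a + k)"
        and "h \<in> carrier G" "\<forall>k. \<phi> h (p k) = p (b + k)"
        using gh by (auto simp: R_def)
      then show ?thesis
        using pE by (auto simp: R_def composition_rule add.assoc intro!: exI[of _ "a + b"])
    qed
  qed (auto simp: R_def)
  have "g \<otimes> h \<otimes> inv g \<otimes> inv h \<in> R" if g: "g \<in> carrier G" and h: "h \<in> carrier G" for g h
  proof -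
    obtain a \<epsilon> where a: "\<epsilon> = 1 \<or> \<epsilon> = -1" "\<forall>k. \<phi> g (p k) = p (a + \<epsilon> * k)"
      using dihedral[OF g] by blast
    obtain b \<delta> where b: "\<delta> = 1 \<or> \<delta> = -1" "\<forall>k. \<phi> h (p k) = p (b + \<delta> * k)"
      using dihedral[OF h] by blast
    have "\<phi> (g \<otimes> h \<otimes> inv g \<otimes> inv h) (p k) = p (a + \<epsilon> * (b + \<delta> * (\<epsilon> * (\<delta> * (k - b) - a))))" for k
      using a(2) b(2) by (simp add: comm_formula[OF g h] inv_formula[OF g a] inv_formula[OF h b])
    moreover have "a + \<epsilon> * (b + \<delta> * (\<epsilon> * (\<delta> * (k - b) - a))) = (a + \<epsilon> * b - b - \<delta> * a) + k" for k
      using a(1) b(1) by auto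
    ultimately show ?thesis using g h by (auto simp: R_def)
  qed
  then have 1: "derived G (carrier G) \<subseteq> R"
    unfolding derived_def by (intro generate_subgroup_incl[OF _ R]) auto
  have "g \<otimes> h \<otimes> inv g \<otimes> inv h \<in> K" if gh: "g \<in> R" "h \<in> R" for g h
  proof -
    obtain a b where g: "g \<in> carrier G" "\<forall>k. \<phi> g (p k) = p (a + 1 * k)"
      and h: "h \<in> carrier G" "\<forall>k. \<phi> h (p k) = p (b + 1 * k)"
      using gh by (auto simp: R_def)
    then show ?thesis
      using inv_formula[OF g(1) _ g(2)] inv_formula[OF h(1) _ h(2)]
      by (auto simp: K_def comm_formula)
  qed
  then have "derived G R \<subseteq> K"
    unfolding derived_def by (intro generate_subgroup_incl[OF _ K]) auto
  then have "derived G (derived G (carrier G)) \<subseteq> K"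
    using mono_derived[OF 1] by simp
  then show ?thesis
    by (auto simp: K_def stabilizer_def numeral_2_eq_2)
qed

text \<open>
  The elements that send \<open>x\<close> to a given point form a coset of the stabilizer of
  \<open>x\<close>.
\<close>

lemma finite_group_of_finite_orbit:
  fixes G (structure)
  assumes act: "group_action G E \<phi>" and x: "x \<in> E" and V: "finite V"
    and orbit: "\<And>g. g \<in> carrier G \<Longrightarrow> \<phi> g x \<in> V"
    and stab: "finite (stabilizer G \<phi> x)"
  shows "finite (carrier G)"
proof -
  interpret group_action G E \<phi> by (rule act)
  interpret group G using group_hom group_hom.axioms(1) by blast
  have "finite {g \<in> carrier G. \<phi> g x = w}" for w
  proof (cases "\<exists>g\<in>carrier G. \<phi> g x = w")
    case True
    then obtain g where g: "g \<in> carrier G" "\<phi> g x = w" by blast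
    have "h \<in> (\<lambda>s. g \<otimes> s) ` stabilizer G \<phi> x" if h: "h \<in> carrier G" "\<phi> h x = w" for h
    proof (rule image_eqI)
      show "h = g \<otimes> (inv g \<otimes> h)" using g h by (simp add: m_assoc[symmetric])
      show "inv g \<otimes> h \<in> stabilizer G \<phi> x"
        using g h x orbit_sym_aux[OF g(1) x g(2)] by (simp add: stabilizer_def composition_rule)
    qed
    then have "{h \<in> carrier G. \<phi> h x = w} \<subseteq> (\<lambda>s. g \<otimes> s) ` stabilizer G \<phi> x" by blast
    then show ?thesis using stab finite_subset by blast
  next
    case False
    then have "{g \<in> carrier G. \<phi> g x = w} = {}" by blast
    then show ?thesis by (rule ssubst) simp
  qed
  moreover have "carrier G \<subseteq> (\<Union>w\<in>V. {g \<in> carrier G. \<phi> g x = w})" using orbit by blast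
  ultimately show ?thesis using V by (meson finite_UN_I finite_subset)
qed

text \<open>
  Take \<open>N\<close> maximal among the proper subgroups that contain the commutator subgroup, and \<open>g \<notin> N\<close>. Then
  \<open>N\<close> is normal, and by maximality the powers of \<open>g\<close> represent all cosets of \<open>N\<close>, so \<open>G/N\<close> is cyclic,
  of order \<open>m\<close> say. Instead of the quotient homomorphism to \<open>\<int>/m\<close> the lemma gives a lift \<open>r\<close> of it to
  the integers, which is additive modulo \<open>m\<close>; this is the form in which rotation angles use it.
\<close>

lemma (in group) cyclic_quotient_of_imperfect:
  assumes fin: "finite (carrier G)" and imperfect: "derived G (carrier G) \<noteq> carrier G"
  obtains N m and r :: "'a \<Rightarrow> int"
  where "subgroup N G" "N \<subset> carrier G" "2 \<le> m"
    "\<And>x y. x \<in> carrier G \<Longrightarrow> y \<in> carrier G \<Longrightarrow> int m dvd r (x \<otimes> y) - (r x + r y)"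
    "\<And>x. x \<in> carrier G \<Longrightarrow> int m dvd r x \<longleftrightarrow> x \<in> N"
proof -
  define \<S> where "\<S> = {N. subgroup N G \<and> derived G (carrier G) \<subseteq> N \<and> N \<noteq> carrier G}"
  have S_sub: "\<S> \<subseteq> Pow (carrier G)" by (auto simp: \<S>_def dest: subgroup.subset)
  then have "finite \<S>" using fin finite_subset by blast
  moreover have "derived G (carrier G) \<in> \<S>"
    using imperfect by (simp add: \<S>_def derived_is_subgroup)
  ultimately obtain N where N: "N \<in> \<S>" and max: "\<And>M. M \<in> \<S> \<Longrightarrow> card M \<le> card N"
    using Max_in[of "card ` \<S>"] Max_ge[of "card ` \<S>"] by fastforce
  have sub: "subgroup N G" and der: "derived G (carrier G) \<subseteq> N" and ne: "N \<noteq> carrier G"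
    using N by (auto simp: \<S>_def)
  interpret N: subgroup N G by (rule sub)
  have comm: "x \<otimes> y \<otimes> inv x \<otimes> inv y \<in> N" if "x \<in> carrier G" "y \<in> carrier G" for x y
  proof -
    have "x \<otimes> y \<otimes> inv x \<otimes> inv y \<in> derived G (carrier G)"
      unfolding derived_def using that by (blast intro: generate.incl)
    then show ?thesis using der by blast
  qed
  have conj: "x \<otimes> n \<otimes> inv x \<in> N" if x: "x \<in> carrier G" and n: "n \<in> N" for x n
  proof -
    have "x \<otimes> n \<otimes> inv x = (x \<otimes> n \<otimes> inv x \<otimes> inv n) \<otimes> n"
      using x n by (simp add: m_assoc)
    then show ?thesis using comm[OF x] n by (metis N.m_closed N.mem_carrier)
  qed
  obtain g where g: "g \<in> carrier G" "g \<notin> N" using ne N.subset by blast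
  \<comment> \<open>the coset of \<open>x\<close> modulo \<open>N\<close> is that of \<open>g [^] k\<close>\<close>
  define P where "P x k \<longleftrightarrow> x \<otimes> g [^] (- k) \<in> N" for x and k :: int
  have P_mult: "P (x \<otimes> y) (k + l)" if "x \<in> carrier G" "y \<in> carrier G" "P x k" "P y l" for x y k l
  proof -
    have "g [^] (- (k + l)) = g [^] (- l) \<otimes> g [^] (- k)"
      using g(1) int_pow_mult[of g "- l" "- k"] by (simp only: minus_add_distrib add.commute)
    then have "x \<otimes> y \<otimes> g [^] (- (k + l))
        = (x \<otimes> (y \<otimes> g [^] (- l)) \<otimes> inv x) \<otimes> (x \<otimes> g [^] (- k))"
      using that(1,2) g by (simp add: m_assoc inv_solve_left)
    then show ?thesis using conj[of x] that by (simp add: P_def)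
  qed
  have P_inv: "P (inv x) (- k)" if x: "x \<in> carrier G" and Px: "P x k" for x k
  proof -
    have "inv (x \<otimes> g [^] (- k)) \<in> N" using Px by (simp add: P_def)
    then have "inv x \<otimes> inv (x \<otimes> g [^] (- k)) \<otimes> inv (inv x) \<in> N" using conj x by blast
    then show ?thesis
      using x g by (simp add: P_def inv_mult_group int_pow_neg m_assoc)
  qed
  have P_unique: "g [^] (k - l) \<in> N" if x: "x \<in> carrier G" and "P x k" "P x l" for x k l
  proof -
    have "inv (x \<otimes> g [^] (- k)) \<otimes> (x \<otimes> g [^] (- l)) \<in> N" using that by (simp add: P_def)
    moreover have "inv (x \<otimes> g [^] (- k)) \<otimes> (x \<otimes> g [^] (- l)) = g [^] k \<otimes> g [^] (- l)"
      using x g by (simp add: inv_mult_group int_pow_neg m_assoc[symmetric] inv_solve_right)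
        (simp add: m_assoc)
    moreover have "\<dots> = g [^] (k - l)" using g by (simp add: int_pow_mult[symmetric])
    ultimately show ?thesis by simp
  qed
  define H where "H = {x \<in> carrier G. \<exists>k. P x k}"
  have "subgroup H G"
  proof (rule subgroupI)
    show "H \<noteq> {}" by (auto simp: H_def P_def intro!: exI[of _ \<one>] exI[of _ 0])
  qed (auto simp: H_def intro: P_mult P_inv)
  moreover have NH: "N \<subseteq> H" by (auto simp: H_def P_def intro!: exI[of _ 0])
  moreover have "g \<in> H" using g(1) by (auto simp: H_def P_def int_pow_neg intro!: exI[of _ 1])
  ultimately have "H = carrier G"
  proof -
    have "N \<subset> H" using NH \<open>g \<in> H\<close> g(2) by blast
    moreover have "finite H" using fin by (simp add: H_def)
    ultimately have "\<not> card H \<le> card N" by (simp add: psubset_card_mono not_le)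
    then have "H \<notin> \<S>" using max by blast
    then show ?thesis using \<open>subgroup H G\<close> der NH by (auto simp: \<S>_def)
  qed
  define r where "r x = (SOME k. P x k)" for x
  have r: "P x (r x)" if "x \<in> carrier G" for x
    using that \<open>H = carrier G\<close> unfolding r_def H_def by (metis (mono_tags, lifting) mem_Collect_eq someI)
  define m where "m = (LEAST m. 0 < m \<and> g [^] (m::nat) \<in> N)"
  have "0 < order G \<and> g [^] order G \<in> N"
    using g fin by (simp add: pow_order_eq_1 order_gt_0_iff_finite)
  then have m: "0 < m" "g [^] m \<in> N" and m_least: "\<And>j. 0 < j \<Longrightarrow> g [^] j \<in> N \<Longrightarrow> m \<le> j"
    unfolding m_def by (metis (mono_tags, lifting) LeastI Least_le)+
  have m_dvd: "g [^] k \<in> N \<longleftrightarrow> int m dvd k" for k :: int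
  proof -
    have mult: "g [^] (int m * j) \<in> N" for j
    proof -
      have "g [^] (int m * j) = (g [^] m) [^] j" using g by (simp add: int_pow_pow[symmetric] int_pow_int)
      also have "\<dots> \<in> N" using m(2) sub
        by (metis subgroup_int_pow_closed)
      finally show ?thesis .
    qed
    have split: "g [^] k = g [^] (int m * (k div int m)) \<otimes> g [^] (k mod int m)"
      using g by (simp add: int_pow_mult[symmetric])
    show ?thesis
    proof
      assume "g [^] k \<in> N"
      then have "g [^] (k mod int m) \<in> N"
        using split mult g by (metis N.m_inv_closed N.m_closed inv_solve_left int_pow_closed)
      moreover have "k mod int m = int (nat (k mod int m))" using m(1) by simp
      ultimately have "g [^] nat (k mod int m) \<in> N" by (metis int_pow_int)
      moreover have "k mod int m < int m" using m(1) by simp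
      then have "\<not> m \<le> nat (k mod int m)" using m(1) by linarith
      ultimately have "nat (k mod int m) = 0" using m_least by blast
      moreover have "0 \<le> k mod int m" using m(1) by simp
      ultimately have "k mod int m = 0" by linarith
      then show "int m dvd k" by (simp add: dvd_eq_mod_eq_0)
    qed (use mult in auto)
  qed
  have "m \<noteq> 1" using m(2) g by auto
  show thesis
  proof (rule that[OF sub])
    show "N \<subset> carrier G" using ne N.subset by blast
    show "2 \<le> m" using \<open>m \<noteq> 1\<close> m(1) by simp
    show "int m dvd r (x \<otimes> y) - (r x + r y)" if "x \<in> carrier G" "y \<in> carrier G" for x y
      using P_unique[OF _ r P_mult[OF that r r]] that m_dvd by simp
    show "int m dvd r x \<longleftrightarrow> x \<in> N" if x: "x \<in> carrier G" for x
    proof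
      assume "x \<in> N"
      then have "P x 0" by (simp add: P_def)
      then show "int m dvd r x" using P_unique[OF x r[OF x]] m_dvd by fastforce
    next
      assume "int m dvd r x"
      then have "g [^] r x \<in> N" using m_dvd by blast
      moreover have "x = (x \<otimes> g [^] (- r x)) \<otimes> g [^] r x"
        using x g by (simp add: int_pow_neg m_assoc)
      ultimately show "x \<in> N" using r[OF x] by (metis N.m_closed P_def)
    qed
  qed
qed

section \<open>The vertices of a compact CW-complex\<close>

text \<open>
  The ball is a closed subset of the cube \<open>[-1,1]\<^sup>\<nat>\<close>, which is compact
  by Tychonoff's theorem.
\<close>

lemma compactin_closed_unit_ball: "compactin (Euclidean_space n) (closed_unit_ball n)"
proof -
  let ?C = "PiE UNIV (\<lambda>i. {-1..1::real})"
  let ?S = "{x::nat \<Rightarrow> real. (\<Sum>i<n. (x i)\<^sup>2) \<in> {..1}}"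
  have "compactin (powertop_real UNIV) ?C"
    by (simp add: compactin_PiE)
  moreover have "closedin (powertop_real UNIV) ?S"
  proof -
    have "continuous_map (powertop_real UNIV) euclideanreal (\<lambda>x. \<Sum>i<n. (x i)\<^sup>2)"
      by (intro continuous_map_sum continuous_map_real_pow continuous_map_product_projection) auto
    then show ?thesis
      using closedin_continuous_map_preimage[of "powertop_real UNIV" euclideanreal
        "\<lambda>x. \<Sum>i<n. (x i)\<^sup>2" "{..1}"] by simp
  qed
  ultimately have "compactin (powertop_real UNIV) (topspace (Euclidean_space n) \<inter> (?S \<inter> ?C))"
    using closedin_Euclidean_space by (blast intro: closed_Int_compactin)
  moreover have "closed_unit_ball n = topspace (Euclidean_space n) \<inter> (?S \<inter> ?C)"
  proof -
    have "\<bar>x i\<bar> \<le> 1" if x: "x \<in> topspace (Euclidean_space n)" "(\<Sum>i<n. (x i)\<^sup>2) \<le> 1" for x i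
    proof (cases "i < n")
      case True
      then have "(x i)\<^sup>2 \<le> (\<Sum>i<n. (x i)\<^sup>2)"
        by (intro member_le_sum) auto
      then show ?thesis using x(2) abs_le_square_iff[of "x i" 1] by simp
    next
      case False
      then show ?thesis using x(1) by (simp add: topspace_Euclidean_space)
    qed
    then show ?thesis by (fastforce simp: closed_unit_ball_def abs_le_iff)
  qed
  ultimately show ?thesis
    by (simp add: Euclidean_space_def compactin_subtopology)
qed

lemma sum_squares_axis:
  fixes n :: nat
  assumes "0 < n"
  shows "(\<Sum>i<n. (if i = 0 then s else 0::real)\<^sup>2) = s\<^sup>2"
proof -
  have "(\<Sum>i<n. (if i = 0 then s else 0::real)\<^sup>2) = (\<Sum>i<n. if i = 0 then s\<^sup>2 else 0)"
    by (intro sum.cong) auto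
  also have "\<dots> = s\<^sup>2" using assms sum.delta[of "{..<n}" 0 "\<lambda>_. s\<^sup>2"] by simp
  finally show ?thesis .
qed

lemma unit_sphere_nonempty: 
  assumes "0 < n" shows "unit_sphere n \<noteq> {}"
  using sum_squares_axis[OF assms, of 1] assms
  by (auto simp: unit_sphere_def topspace_Euclidean_space intro!: exI[of _ "\<lambda>i. if i = 0 then 1 else 0"])

lemma cell_eq_image_open_ball:
  assumes "characteristic_map X n e f" and "e \<subseteq> topspace (cw_space X)"
  shows "f ` open_unit_ball n = e" and "inj_on f (open_unit_ball n)"
proof -
  have "homeomorphic_map (subtopology (Euclidean_space n) (open_unit_ball n))
                      (subtopology (cw_space X) e) f"
    using assms(1) by (simp add: characteristic_map_def)
  moreover have "topspace (subtopology (Euclidean_space n) (open_unit_ball n)) = open_unit_ball n"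
    by (auto simp: open_unit_ball_def)
  moreover have "topspace (subtopology (cw_space X) e) = e" using assms(2) by auto
  ultimately show "f ` open_unit_ball n = e" "inj_on f (open_unit_ball n)"
    by (metis homeomorphic_imp_surjective_map, metis homeomorphic_imp_injective_map)
qed

lemma cell_subset_topspace: "cw_complex X \<Longrightarrow> e \<in> cw_cells X n \<Longrightarrow> e \<subseteq> topspace (cw_space X)"
  by (force simp: cw_complex_def all_cells_def)

lemma cell_has_characteristic_map:
  assumes "cw_complex X" "e \<in> cw_cells X n"
  obtains f where "characteristic_map X n e f"
  using assms unfolding cw_complex_def by meson

text \<open>
  An open ball of positive dimension has more than one point. So vertices are recognised among
  all cells as the singletons, and homeomorphisms that permute the cells permute the vertices.
\<close>

lemma singleton_cell_dim:
  assumes X: "cw_complex X" and e: "{v} \<in> cw_cells X n"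
  shows "n = 0"
proof (rule ccontr)
  assume n: "n \<noteq> 0"
  obtain f where f: "characteristic_map X n {v} f"
    using cell_has_characteristic_map[OF X e] .
  define axis :: "real \<Rightarrow> nat \<Rightarrow> real" where "axis s = (\<lambda>i. if i = 0 then s else 0)" for s
  have axis: "axis s \<in> open_unit_ball n" if "s\<^sup>2 < 1" for s
    using that n sum_squares_axis[of n s]
    by (auto simp: axis_def open_unit_ball_def topspace_Euclidean_space)
  have 0: "axis 0 \<in> open_unit_ball n" by (rule axis) simp
  have half: "axis (1/2) \<in> open_unit_ball n" by (rule axis) (simp add: power2_eq_square)
  note ball = cell_eq_image_open_ball[OF f cell_subset_topspace[OF X e]]
  have "f (axis 0) = f (axis (1/2))" using ball(1) imageI[OF 0, of f] imageI[OF half, of f] by simp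
  then have "axis 0 = axis (1/2)" using inj_onD[OF ball(2) _ 0 half] by blast
  from fun_cong[OF this, of 0] show False by (simp add: axis_def)
qed

lemma zero_cell_singleton:
  assumes X: "cw_complex X" and e: "e \<in> cw_cells X 0"
  obtains v where "e = {v}"
proof -
  obtain f where f: "characteristic_map X 0 e f"
    using cell_has_characteristic_map[OF X e] .
  have "open_unit_ball 0 = {\<lambda>_. 0}"
    by (auto simp: open_unit_ball_def topspace_Euclidean_space)
  then show thesis
    using cell_eq_image_open_ball(1)[OF f cell_subset_topspace[OF X e]] that by auto
qed

definition vertices :: "'x cw \<Rightarrow> 'x set" where
  "vertices X = \<Union>(cw_cells X 0)"

lemma vertices_iff:
  assumes "cw_complex X" shows "v \<in> vertices X \<longleftrightarrow> {v} \<in> all_cells X"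
proof
  assume "v \<in> vertices X"
  then obtain e where "e \<in> cw_cells X 0" "v \<in> e" by (auto simp: vertices_def)
  then show "{v} \<in> all_cells X"
    using zero_cell_singleton[OF assms] by (metis UN_I UNIV_I all_cells_def singletonD)
next
  assume "{v} \<in> all_cells X"
  then show "v \<in> vertices X"
    using singleton_cell_dim[OF assms] by (auto simp: all_cells_def vertices_def)
qed

lemma vertices_Int_cell:
  assumes X: "cw_complex X" and e: "e \<in> cw_cells X n"
  shows "finite (vertices X \<inter> e)"
proof (cases "vertices X \<inter> e = {}")
  case False
  then obtain v d where d: "d \<in> cw_cells X 0" "v \<in> d" "v \<in> e" by (auto simp: vertices_def)
  then have "(0, d) = (n, e)" using X e unfolding cw_complex_def by blast
  then obtain w where "e = {w}" using zero_cell_singleton[OF X] d(1) by auto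
  then show ?thesis by simp
qed simp

text \<open>
  A cell of least dimension has nothing to attach its boundary sphere to, so that sphere is
  empty and the dimension is 0.
\<close>

lemma vertices_nonempty:
  assumes X: "cw_complex X" and ne: "topspace (cw_space X) \<noteq> {}"
  shows "vertices X \<noteq> {}"
proof -
  have "\<Union>(all_cells X) \<noteq> {}" using X ne by (simp add: cw_complex_def)
  then have ex: "\<exists>n. cw_cells X n \<noteq> {}" by (auto simp: all_cells_def)
  define n where "n = (LEAST n. cw_cells X n \<noteq> {})"
  have "cw_cells X n \<noteq> {}" unfolding n_def using ex by (rule LeastI_ex)
  then obtain e where e: "e \<in> cw_cells X n" by blast
  have least: "cw_cells X m = {}" if "m < n" for m using not_less_Least[of m] that unfolding n_def by blast
  obtain f where f: "characteristic_map X n e f"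
    using cell_has_characteristic_map[OF X e] .
  then obtain F where "F \<subseteq> (\<Union>m<n. cw_cells X m)" "f ` unit_sphere n \<subseteq> \<Union>F"
    unfolding characteristic_map_def by blast
  then have "f ` unit_sphere n = {}" using least by auto
  then have "n = 0" using unit_sphere_nonempty by blast
  then obtain v where "e = {v}" using zero_cell_singleton[OF X] e by auto
  then show ?thesis using e \<open>n = 0\<close> by (auto simp: vertices_def)
qed

text \<open>
  The closure of a cell is covered by the image of the closed ball, because that image is
  compact. By closure-finiteness it meets only finitely many cells, each of which contains at
  most one vertex.
\<close>

lemma vertices_Int_closure_cell_finite:
  assumes X: "cw_complex X" and e: "e \<in> all_cells X"
  shows "finite (vertices X \<inter> cw_space X closure_of e)"
proof -
  obtain n where n: "e \<in> cw_cells X n" using e by (auto simp: all_cells_def)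
  obtain f where f: "characteristic_map X n e f"
    using cell_has_characteristic_map[OF X n] .
  have cont: "continuous_map (subtopology (Euclidean_space n) (closed_unit_ball n)) (cw_space X) f"
    using f by (simp add: characteristic_map_def)
  obtain F where F: "finite F" "F \<subseteq> (\<Union>m<n. cw_cells X m)" "f ` unit_sphere n \<subseteq> \<Union>F"
    using f by (auto simp: characteristic_map_def)
  have "compactin (cw_space X) (f ` closed_unit_ball n)"
    using image_compactin[OF _ cont] compactin_closed_unit_ball
    by (simp add: compactin_subtopology)
  then have "closedin (cw_space X) (f ` closed_unit_ball n)"
    using X by (simp add: cw_complex_def compactin_imp_closedin)
  moreover have ball: "closed_unit_ball n = open_unit_ball n \<union> unit_sphere n"
    by (auto simp: closed_unit_ball_def open_unit_ball_def unit_sphere_def)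
  moreover have open_ball: "f ` open_unit_ball n = e"
    using cell_eq_image_open_ball(1)[OF f cell_subset_topspace[OF X n]] .
  ultimately have "cw_space X closure_of e \<subseteq> f ` closed_unit_ball n"
    by (intro closure_of_minimal) auto
  also have "\<dots> \<subseteq> e \<union> \<Union>F" using F(3) ball open_ball by auto
  finally have "vertices X \<inter> cw_space X closure_of e
      \<subseteq> (vertices X \<inter> e) \<union> (\<Union>d\<in>F. vertices X \<inter> d)" by blast
  moreover have "finite (vertices X \<inter> d)" if "d \<in> F" for d
    using that F(2) vertices_Int_cell[OF X] by blast
  ultimately show ?thesis
    using vertices_Int_cell[OF X n] F(1) by (meson finite_UN_I finite_Un finite_subset)
qed

text \<open>
  In the weak topology every set of vertices is closed, so the vertices form a closed discrete
  subset of a compact space.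
\<close>

lemma vertices_finite:
  assumes X: "cw_complex X" and comp: "compact_space (cw_space X)"
  shows "finite (vertices X)"
proof -
  have sub: "vertices X \<subseteq> topspace (cw_space X)"
    using cell_subset_topspace[OF X] by (auto simp: vertices_def)
  have closed: "closedin (cw_space X) A" if A: "A \<subseteq> vertices X" for A
  proof -
    have "closedin (cw_space X) (A \<inter> cw_space X closure_of e)" if e: "e \<in> all_cells X" for e
    proof (rule closedin_Hausdorff_finite)
      show "Hausdorff_space (cw_space X)" using X by (simp add: cw_complex_def)
      show "finite (A \<inter> cw_space X closure_of e)"
        using A by (intro finite_subset[OF _ vertices_Int_closure_cell_finite[OF X e]]) blast
      show "A \<inter> cw_space X closure_of e \<subseteq> topspace (cw_space X)" using A sub by blast
    qed
    moreover have "A \<subseteq> topspace (cw_space X)" using A sub by blast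
    ultimately show ?thesis using X by (simp add: cw_complex_def)
  qed
  have "cw_space X derived_set_of vertices X = {}"
  proof -
    have False if x: "x \<in> cw_space X derived_set_of vertices X" for x
    proof -
      have "openin (cw_space X) (topspace (cw_space X) - (vertices X - {x}))"
        using closed by blast
      moreover have "x \<in> topspace (cw_space X)" using x by (simp add: in_derived_set_of)
      ultimately obtain y where "y \<noteq> x" "y \<in> vertices X" "y \<in> topspace (cw_space X) - (vertices X - {x})"
        using conjunct2[OF x[unfolded in_derived_set_of],
            THEN spec[of _ "topspace (cw_space X) - (vertices X - {x})"]] by auto
      then show False by blast
    qed
    then show ?thesis by blast
  qed
  moreover have "compactin (cw_space X) (vertices X)"
    using closed comp closedin_compact_space by blast
  ultimately show ?thesis
    using discrete_compactin_eq_finite[of "vertices X" "cw_space X"] by simp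
qed

lemma cellular_action_vertices:
  assumes X: "cw_complex X" and act: "cellular_action G X \<phi>"
    and g: "g \<in> carrier G" and v: "v \<in> vertices X"
  shows "\<phi> g v \<in> vertices X"
proof -
  have "\<phi> g ` {v} \<in> all_cells X"
    using act g v vertices_iff[OF X] unfolding cellular_action_def by blast
  then have "{\<phi> g v} \<in> all_cells X" by simp
  then show ?thesis using vertices_iff[OF X] by blast
qed

section \<open>Homeomorphisms of the circle that preserve a finite set\<close>

lemma cis_eq_cis_iff: "cis a = cis b \<longleftrightarrow> (\<exists>q::int. a = b + 2 * pi * of_int q)"
  using sin_cos_eq_iff[of a b] by (auto simp: complex_eq_iff)

text \<open>
  The angles, in increasing order, of a set of \<open>n\<close> points on the circle, continued periodically to all
  of \<open>\<int>\<close>. The integer indices make rotations and reflections of the points affine maps.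
\<close>

locale cyclic_enumeration =
  fixes t :: "int \<Rightarrow> real" and n :: nat
  assumes n_pos: "0 < n"
    and step: "t k < t (k + 1)"
    and period: "t (k + int n) = t k + 2 * pi"
begin

abbreviation p :: "int \<Rightarrow> complex" where "p k \<equiv> cis (t k)"

lemma strict_mono_t: "strict_mono t"
proof -
  have "t k < t l" if "k < l" for k l
    using that
  proof (induction l rule: int_gr_induct)
    case base
    show ?case by (rule step)
  next
    case (step l)
    then show ?case using cyclic_enumeration.step[OF cyclic_enumeration_axioms] less_trans by blast
  qed
  then show ?thesis by (rule strict_monoI)
qed

lemma t_less_iff: "t k < t l \<longleftrightarrow> k < l"
  using strict_mono_t by (rule strict_mono_less)

lemma period_multiple: "t (k + q * int n) = t k + 2 * pi * of_int q"
proof (induction q rule: int_induct[where k = 0])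
  case (step1 q)
  then show ?case using period[of "k + q * int n"] by (simp add: algebra_simps)
next
  case (step2 q)
  then show ?case using period[of "k + (q - 1) * int n"] by (simp add: algebra_simps)
qed simp

lemma p_eq_iff: "p k = p l \<longleftrightarrow> int n dvd k - l"
proof
  assume "p k = p l"
  then obtain q :: int where "t k = t l + 2 * pi * of_int q" using cis_eq_cis_iff by blast
  then have "t k = t (l + q * int n)" by (simp add: period_multiple)
  then have "k = l + q * int n" using strict_mono_eq[OF strict_mono_t] by blast
  then show "int n dvd k - l" by simp
next
  assume "int n dvd k - l"
  then obtain q where "k = l + q * int n" by (metis add.commute diff_add_cancel dvdE mult.commute)
  then show "p k = p l" using cis_eq_cis_iff period_multiple by blast
qed

lemma p_shift: "p k = p l \<Longrightarrow> p (a + c * k) = p (a + c * l)"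
proof -
  have "a + c * k - (a + c * l) = c * (k - l)" by (simp add: algebra_simps)
  then show "p k = p l \<Longrightarrow> p (a + c * k) = p (a + c * l)" unfolding p_eq_iff by simp
qed

lemma open_arc_disjoint_vertices:
  assumes "t k < \<theta>" "\<theta> < t (k + 1)" shows "cis \<theta> \<notin> range p"
proof
  assume "cis \<theta> \<in> range p"
  then obtain l and q :: int where "\<theta> = t l + 2 * pi * of_int q" using cis_eq_cis_iff by blast
  then have "\<theta> = t (l + q * int n)" by (simp add: period_multiple)
  then show False using assms t_less_iff by auto
qed

lemma open_arcs_disjoint:
  assumes "t k < \<theta>" "\<theta> < t (k + 1)" "t l < \<eta>" "\<eta> < t (l + 1)" "cis \<theta> = cis \<eta>"
  shows "int n dvd k - l"
proof -
  obtain q :: int where q: "\<theta> = \<eta> + 2 * pi * of_int q" using assms(5) cis_eq_cis_iff by blast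
  then have "t (l + q * int n) < \<theta>" "\<theta> < t (l + 1 + q * int n)"
    using assms(3,4) period_multiple[of l q] period_multiple[of "l + 1" q] by auto
  then have "t k < t (l + 1 + q * int n)" "t (l + q * int n) < t (k + 1)"
    using assms(1,2) by linarith+
  then have "k = l + q * int n" using t_less_iff by simp
  then show ?thesis by simp
qed

definition arc :: "int \<Rightarrow> complex set" where "arc k = cis ` {t k..t (k + 1)}"

lemma closed_arc: "closed (arc k)"
  unfolding arc_def by (intro compact_imp_closed compact_continuous_image continuous_intros) auto

lemma arc_Int_vertices: "arc k \<inter> range p \<subseteq> {p k, p (k + 1)}"
proof
  fix z assume z: "z \<in> arc k \<inter> range p"
  then obtain \<theta> where \<theta>: "t k \<le> \<theta>" "\<theta> \<le> t (k + 1)" "z = cis \<theta>" by (auto simp: arc_def)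
  have "\<theta> = t k \<or> \<theta> = t (k + 1)"
  proof (rule ccontr)
    assume "\<not> (\<theta> = t k \<or> \<theta> = t (k + 1))"
    then have "cis \<theta> \<notin> range p" using \<theta>(1,2) by (intro open_arc_disjoint_vertices[of k]) auto
    then show False using z \<theta>(3) by simp
  qed
  then show "z \<in> {p k, p (k + 1)}" using \<theta>(3) by auto
qed

text \<open>
  Shift the argument of the point by a multiple of \<open>2\<pi>\<close> into the period that
  starts at \<open>t 0\<close>, and take the last vertex before it.
\<close>

lemma sphere_covered_by_arcs:
  assumes "norm z = 1" shows "\<exists>k\<in>{0..<int n}. z \<in> arc k"
proof -
  define q where "q = \<lfloor>(Arg z - t 0) / (2 * pi)\<rfloor>"
  define \<theta> where "\<theta> = Arg z - 2 * pi * of_int q"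
  have "z \<noteq> 0" using assms by auto
  then have "z = cis (Arg z)" using assms by (simp add: cis_Arg sgn_div_norm)
  then have z: "z = cis \<theta>" using cis_eq_cis_iff[of "Arg z" \<theta>] by (auto simp: \<theta>_def)
  have "of_int q \<le> (Arg z - t 0) / (2 * pi)" "(Arg z - t 0) / (2 * pi) < of_int q + 1"
    unfolding q_def by linarith+
  then have \<theta>: "t 0 \<le> \<theta>" "\<theta> < t 0 + 2 * pi" by (auto simp: \<theta>_def field_simps)
  define k where "k = Max {k\<in>{0..<int n}. t k \<le> \<theta>}"
  have ne: "0 \<in> {k\<in>{0..<int n}. t k \<le> \<theta>}" using \<theta>(1) n_pos by simp
  have fin: "finite {k\<in>{0..<int n}. t k \<le> \<theta>}" by (rule finite_subset[of _ "{0..<int n}"]) auto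
  have "k \<in> {k\<in>{0..<int n}. t k \<le> \<theta>}" unfolding k_def using Max_in[OF fin] ne by blast
  then have k: "k \<in> {0..<int n}" "t k \<le> \<theta>" by auto
  have "\<theta> < t (k + 1)"
  proof (cases "k + 1 < int n")
    case True
    show ?thesis
    proof (rule ccontr)
      assume "\<not> \<theta> < t (k + 1)"
      then have "k + 1 \<in> {k\<in>{0..<int n}. t k \<le> \<theta>}" using True k(1) by simp
      then have "k + 1 \<le> k" using Max_ge[OF fin] k_def by blast
      then show False by simp
    qed
  next
    case False
    then have "k + 1 = int n" using k(1) by simp
    then show ?thesis using \<theta>(2) period[of 0] by simp
  qed
  then have "z \<in> arc k" using k z by (simp add: arc_def)
  then show ?thesis using k(1) by blast
qed

text \<open>
  The map \<open>h\<close> is to be thought of as a homeomorphism of the circle composed with \<open>cis\<close>. The image of an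
  open arc is connected and avoids the vertices. The circle is covered by finitely many closed arcs,
  which overlap only in vertices, so the image lies in one of them. By continuity the images of the
  two end points lie in the same closed arc; being vertices, they are end points of it.
\<close>

lemma adjacent_images:
  fixes h :: "real \<Rightarrow> complex"
  assumes cont: "continuous_on UNIV h" and norm: "\<And>\<theta>. norm (h \<theta>) = 1"
    and vertices: "\<And>\<theta>. h \<theta> \<in> range p \<longleftrightarrow> cis \<theta> \<in> range p"
  shows "\<exists>l. h (t k) \<in> {p l, p (l + 1)} \<and> h (t (k + 1)) \<in> {p l, p (l + 1)}"
proof -
  let ?I = "{t k<..<t (k + 1)}"
  let ?C = "h ` ?I"
  have no_vertex: "z \<notin> range p" if z: "z \<in> ?C" for z
  proof -
    obtain \<theta> where \<theta>: "t k < \<theta>" "\<theta> < t (k + 1)" "z = h \<theta>" using z by auto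
    show ?thesis using open_arc_disjoint_vertices[OF \<theta>(1,2)] vertices[of \<theta>] \<theta>(3) by simp
  qed
  obtain \<theta> where "\<theta> \<in> ?I" using dense[OF step[of k]] by auto
  then obtain l where l: "l \<in> {0..<int n}" "h \<theta> \<in> arc l"
    using sphere_covered_by_arcs[OF norm] by blast
  define B where "B = (\<Union>j\<in>{0..<int n} - {l}. arc j)"
  have "?C \<subseteq> arc l \<union> B"
    using sphere_covered_by_arcs[OF norm] by (fastforce simp: B_def)
  moreover have "arc l \<inter> B \<inter> ?C = {}"
  proof -
    have False if z: "z \<in> arc l" "z \<in> arc j" "z \<in> ?C" and j: "j \<in> {0..<int n} - {l}" for z j
    proof -
      obtain \<alpha> where \<alpha>: "t l \<le> \<alpha>" "\<alpha> \<le> t (l + 1)" "z = cis \<alpha>" using z(1) by (auto simp: arc_def)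
      obtain \<beta> where \<beta>: "t j \<le> \<beta>" "\<beta> \<le> t (j + 1)" "z = cis \<beta>" using z(2) by (auto simp: arc_def)
      have "z \<noteq> p i" for i using no_vertex[OF z(3)] by blast
      then have "\<alpha> \<noteq> t l" "\<alpha> \<noteq> t (l + 1)" "\<beta> \<noteq> t j" "\<beta> \<noteq> t (j + 1)" using \<alpha>(3) \<beta>(3) by blast+
      then have "int n dvd l - j"
        using open_arcs_disjoint[of l \<alpha> j \<beta>] \<alpha> \<beta> by simp
      moreover have "\<bar>l - j\<bar> < int n" "l - j \<noteq> 0" using l(1) j by auto
      ultimately show False using dvd_imp_le_int[of "l - j" "int n"] by linarith
    qed
    then show ?thesis unfolding B_def by blast
  qed
  moreover have "connected ?C"
    using cont by (intro connected_continuous_image) (auto intro: continuous_on_subset)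
  moreover have "closed B" unfolding B_def by (intro closed_UN) (auto intro: closed_arc)
  moreover have "arc l \<inter> ?C \<noteq> {}" using l(2) \<open>\<theta> \<in> ?I\<close> by blast
  ultimately have "B \<inter> ?C = {}"
    using connected_closedD[of ?C "arc l" B] closed_arc by blast
  then have "?C \<subseteq> arc l" using \<open>?C \<subseteq> arc l \<union> B\<close> by blast
  then have "h ` closure ?I \<subseteq> arc l"
    using image_closure_subset[of ?I h "arc l"] closed_arc cont continuous_on_subset by blast
  then have "h ` {t k..t (k + 1)} \<subseteq> arc l" using step[of k] by simp
  moreover have "t k \<in> {t k..t (k + 1)}" "t (k + 1) \<in> {t k..t (k + 1)}" using step[of k] by auto
  ultimately have "h (t k) \<in> arc l" "h (t (k + 1)) \<in> arc l" by blast+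
  moreover have "h (t k) \<in> range p" "h (t (k + 1)) \<in> range p" using vertices by blast+
  ultimately show ?thesis using arc_Int_vertices[of l] by blast
qed

text \<open>
  If there is more than one vertex, the images \<open>q\<close> of consecutive vertices are distinct neighbours,
  so each step of \<open>q\<close> goes one vertex forward or one back. The direction cannot change: a reversal would give \<open>q (k + 2) = q k\<close>, which
  happens only if there are at most two vertices, and then both directions agree.
\<close>

lemma dihedral_of_adjacent:
  fixes q :: "int \<Rightarrow> complex"
  assumes adj: "\<And>k. \<exists>l. q k \<in> {p l, p (l + 1)} \<and> q (k + 1) \<in> {p l, p (l + 1)}"
    and inj: "\<And>k l. q k = q l \<longleftrightarrow> p k = p l"
  shows "\<exists>a \<epsilon>. (\<epsilon> = 1 \<or> \<epsilon> = -1) \<and> (\<forall>k. q k = p (a + \<epsilon> * k))"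
proof (cases "p 0 = p 1")
  case True
  then have "int n dvd 1" using p_eq_iff[of 1 0] by simp
  then have const: "p k = p l" for k l using p_eq_iff dvd_trans one_dvd by blast
  have "q k = p (0 + 1 * k)" for k using adj[of k] const[of _ "0 + 1 * k"] by fastforce
  then show ?thesis by blast
next
  case False
  then have distinct: "p k \<noteq> p (k + 1)" for k
    using p_eq_iff[of k "k + 1"] p_eq_iff[of 0 1] by simp
  have step_forward: "q (k + 1) = p (a + 1) \<or> q (k + 1) = p (a - 1)" if a: "q k = p a" for k a
  proof -
    obtain l where l: "q k \<in> {p l, p (l + 1)}" "q (k + 1) \<in> {p l, p (l + 1)}" using adj by blast
    have ne: "q k \<noteq> q (k + 1)" using inj distinct by blast
    show ?thesis
    proof (cases "q k = p l")
      case True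
      then have "q (k + 1) = p (l + 1)" using l ne by auto
      then show ?thesis using True a p_shift[of l a 1 1] by (simp add: add.commute)
    next
      case False
      then have "q k = p (l + 1)" "q (k + 1) = p l" using l ne by auto
      then show ?thesis using a p_shift[of "l + 1" a "-1" 1] by (simp add: algebra_simps)
    qed
  qed
  have step_backward: "q (k - 1) = p (a + 1) \<or> q (k - 1) = p (a - 1)" if a: "q k = p a" for k a
  proof -
    obtain b where b: "q (k - 1) = p b" using adj[of "k - 1"] by auto
    then have "p a = p (b + 1) \<or> p a = p (b - 1)" using step_forward[OF b] a by simp
    then show ?thesis
      using b p_shift[of a "b + 1" "-1" 1] p_shift[of a "b - 1" 1 1] by (auto simp: algebra_simps)
  qed
  obtain a where a: "q 0 = p a" using adj[of 0] by auto
  obtain \<epsilon> where \<epsilon>: "\<epsilon> = 1 \<or> \<epsilon> = -1" "q 1 = p (a + \<epsilon>)"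
    using step_forward[OF a]
    by (auto simp: diff_conv_add_uminus simp del: add_uminus_conv_diff)
  \<comment> \<open>a reversal of direction forces the number of vertices to divide 2\<close>
  have two: "p (j + 2) = p j" if "q (k + 2) = q k" for j k
    using that inj p_eq_iff[of "k + 2" k] p_eq_iff[of "j + 2" j] by simp
  have "q k = p (a + \<epsilon> * k) \<and> q (k + 1) = p (a + \<epsilon> * (k + 1))" for k
  proof (induction k rule: int_induct[where k = 0])
    case base
    then show ?case using a \<epsilon> by simp
  next
    case (step1 k)
    have "q (k + 2) = p (a + \<epsilon> * (k + 2)) \<or> q (k + 2) = p (a + \<epsilon> * k)"
      using step_forward[of "k + 1" "a + \<epsilon> * (k + 1)"] step1(2) \<epsilon>(1) by (auto simp: algebra_simps)
    then have "q (k + 2) = p (a + \<epsilon> * (k + 2))"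
      using step1(2) two[of k "a + \<epsilon> * k"] two[of k "a + \<epsilon> * (k + 2)"] \<epsilon>(1)
      by (auto simp: algebra_simps)
    then show ?case using step1(2) by (simp add: algebra_simps)
  next
    case (step2 k)
    have "q (k - 1) = p (a + \<epsilon> * (k - 1)) \<or> q (k - 1) = p (a + \<epsilon> * (k + 1))"
      using step_backward[of k "a + \<epsilon> * k"] step2(2) \<epsilon>(1) by (auto simp: algebra_simps)
    then have "q (k - 1) = p (a + \<epsilon> * (k - 1))"
      using step2(2) two[of "k - 1" "a + \<epsilon> * (k - 1)"] two[of "k - 1" "a + \<epsilon> * (k + 1)"] \<epsilon>(1)
      by (auto simp: algebra_simps)
    then show ?case using step2(2) by simp
  qed
  then show ?thesis using \<epsilon>(1) by blast
qed

end

lemma finite_circle_subset_cyclic_enumeration: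
  fixes W :: "complex set"
  assumes fin: "finite W" and ne: "W \<noteq> {}" and sub: "W \<subseteq> sphere 0 1"
  obtains t n where "cyclic_enumeration t n" "range (\<lambda>k. cis (t k)) = W"
proof -
  define A where "A = {\<theta>\<in>{0..<2 * pi}. cis \<theta> \<in> W}"
  have "inj_on cis A"
  proof (rule inj_onI)
    fix a b assume ab: "a \<in> A" "b \<in> A" "cis a = cis b"
    then obtain q :: int where q: "a = b + 2 * pi * of_int q" using cis_eq_cis_iff by blast
    then have "\<bar>2 * pi * of_int q\<bar> < 2 * pi * 1" using ab by (auto simp: A_def)
    then have "\<bar>of_int q\<bar> < (1::real)" by (simp add: abs_mult)
    then have "q = 0" by linarith
    then show "a = b" using q by simp
  qed
  moreover have "cis ` A = W"
  proof -
    have "w \<in> cis ` A" if w: "w \<in> W" for w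
    proof -
      have "norm w = 1" using w sub by auto
      then obtain \<theta> where "0 \<le> \<theta>" "\<theta> < 2 * pi" "w = Complex (cos \<theta>) (sin \<theta>)"
        using complex_unimodular_polar by blast
      then show ?thesis using w by (auto simp: A_def cis.ctr)
    qed
    then show ?thesis by (auto simp: A_def)
  qed
  ultimately have finA: "finite A" and neA: "A \<noteq> {}" using fin ne finite_image_iff by fastforce+
  define L where "L = sorted_list_of_set A"
  define n where "n = length L"
  \<comment> \<open>going on past \<open>n\<close> angles adds a full turn\<close>
  define t where "t k = L ! nat (k mod int n) + 2 * pi * of_int (k div int n)" for k
  have setL: "set L = A" and sorted: "sorted_wrt (<) L" using finA by (simp_all add: L_def)
  have n: "0 < n" using neA setL by (auto simp: n_def)
  have "cyclic_enumeration t n"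
  proof
    show "0 < n" by (rule n)
    show "t (k + int n) = t k + 2 * pi" for k
      using n by (simp add: t_def algebra_simps)
    show "t k < t (k + 1)" for k
    proof -
      define j d where "j = k mod int n" and "d = k div int n"
      have k: "k = d * int n + j" and j: "0 \<le> j" "j < int n" using n by (simp_all add: j_def d_def)
      show ?thesis
      proof (cases "j + 1 < int n")
        case True
        then have "(k + 1) mod int n = j + 1" "(k + 1) div int n = d"
          using k j by (simp_all add: add.assoc)
        moreover have "L ! nat j < L ! nat (j + 1)"
          using sorted_wrt_nth_less[OF sorted, of "nat j" "nat (j + 1)"] True j
          by (simp add: n_def nat_less_iff)
        ultimately show ?thesis by (simp add: t_def flip: j_def d_def)
      next
        case False
        then have "k + 1 = (d + 1) * int n" using k j by (simp add: algebra_simps)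
        then have "(k + 1) mod int n = 0" "(k + 1) div int n = d + 1" using n by simp_all
        moreover have "L ! nat j \<in> A" "L ! 0 \<in> A"
          using setL j n nth_mem[of "nat j" L] nth_mem[of 0 L] by (auto simp: n_def)
        ultimately show ?thesis by (auto simp: t_def A_def algebra_simps simp flip: j_def d_def)
      qed
    qed
  qed
  moreover have "range (\<lambda>k. cis (t k)) = W"
  proof -
    have "cis (t k) = cis (L ! nat (k mod int n))" for k
      using cis_eq_cis_iff unfolding t_def by blast
    moreover have "range (\<lambda>k. L ! nat (k mod int n)) = set L"
    proof -
      have "x \<in> range (\<lambda>k. L ! nat (k mod int n))" if "x \<in> set L" for x
      proof -
        obtain i where "i < n" "x = L ! i" using \<open>x \<in> set L\<close> by (auto simp: in_set_conv_nth n_def)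
        then have "x = L ! nat (int i mod int n)" by simp
        then show ?thesis by blast
      qed
      moreover have "L ! nat (k mod int n) \<in> set L" for k
        using n by (intro nth_mem) (simp add: n_def[symmetric] nat_less_iff)
      ultimately show ?thesis by blast
    qed
    ultimately show ?thesis using \<open>cis ` A = W\<close> setL by (metis (no_types, lifting) image_cong image_image)
  qed
  ultimately show thesis using that by blast
qed

text \<open>
  Transport everything to the unit circle, where \<open>adjacent_images\<close> and
  \<open>dihedral_of_adjacent\<close> apply: an injective map that sends the finite set
  \<open>V\<close> into itself permutes it and sends no other point into it. The same
  enumeration serves all maps at once.
\<close>

lemma homeomorphic_circle_dihedral_enumeration:
  fixes X :: "'x topology"
  assumes hom: "X homeomorphic_space top_of_set (sphere (0::complex) 1)"
    and fin: "finite V" and ne: "V \<noteq> {}" and sub: "V \<subseteq> topspace X"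
  obtains P :: "int \<Rightarrow> 'x" where "\<And>k. P k \<in> V"
    "\<And>f. continuous_map X X f \<Longrightarrow> inj_on f (topspace X) \<Longrightarrow> f ` V \<subseteq> V \<Longrightarrow>
       \<exists>a \<epsilon>. (\<epsilon> = 1 \<or> \<epsilon> = -1) \<and> (\<forall>k. f (P k) = P (a + \<epsilon> * k))"
proof -
  obtain H K where HK: "homeomorphic_maps X (top_of_set (sphere (0::complex) 1)) H K"
    using hom by (auto simp: homeomorphic_space_def)
  have H: "continuous_map X (top_of_set (sphere 0 1)) H"
    and K: "continuous_map (top_of_set (sphere 0 1)) X K"
    and KH: "\<And>x. x \<in> topspace X \<Longrightarrow> K (H x) = x" and HK': "\<And>z. norm z = 1 \<Longrightarrow> H (K z) = z"
    using HK by (auto simp: homeomorphic_maps_def)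
  have H_norm: "norm (H x) = 1" if "x \<in> topspace X" for x
    using H that by (auto simp: continuous_map_def Pi_iff)
  have K_top: "K z \<in> topspace X" if "norm z = 1" for z
    using K that by (auto simp: continuous_map_def Pi_iff)
  have "H ` V \<subseteq> sphere 0 1" using H_norm sub by auto
  then obtain t n where enum: "cyclic_enumeration t n" and range: "range (\<lambda>k. cis (t k)) = H ` V"
    using finite_circle_subset_cyclic_enumeration[OF finite_imageI[OF fin]] ne by blast
  interpret cyclic_enumeration t n by (rule enum)
  define P where "P k = K (p k)" for k
  have PV: "P k \<in> V" for k
  proof -
    have "p k \<in> H ` V" using range by blast
    then show ?thesis using KH sub by (auto simp: P_def)
  qed
  show thesis
  proof (rule that[of P, OF PV])
    fix f assume cont: "continuous_map X X f" and inj: "inj_on f (topspace X)" and fV: "f ` V \<subseteq> V"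
    have f_top: "f x \<in> topspace X" if "x \<in> topspace X" for x
      using cont that by (auto simp: continuous_map_def Pi_iff)
    have "inj_on f V" using inj sub inj_on_subset by blast
    then have fV_eq: "f ` V = V" using endo_inj_surj[OF fin fV] by blast
    have f_vertex: "f x \<in> V \<longleftrightarrow> x \<in> V" if "x \<in> topspace X" for x
    proof
      assume "f x \<in> V"
      then obtain y where "y \<in> V" "f y = f x" using fV_eq by (metis imageE)
      then show "x \<in> V" using inj_onD[OF inj _ _ that] sub by blast
    qed (use fV in blast)
    have H_vertex: "H x \<in> range p \<longleftrightarrow> x \<in> V" if "x \<in> topspace X" for x
    proof
      assume "H x \<in> range p"
      then obtain v where "v \<in> V" "H x = H v" using range by (metis imageE)
      then show "x \<in> V" using KH[OF that] KH[of v] sub by auto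
    qed (use range in blast)
    define h where "h = (\<lambda>\<theta>. H (f (K (cis \<theta>))))"
    have "continuous_map euclideanreal (top_of_set (sphere 0 1)) cis"
      by (simp add: continuous_map_in_subtopology continuous_on_cis)
    then have "continuous_map euclideanreal (top_of_set (sphere 0 1)) (H \<circ> f \<circ> K \<circ> cis)"
      using H cont K by (intro continuous_map_compose)
    then have h_cont: "continuous_on UNIV h"
      by (simp add: continuous_map_in_subtopology h_def o_def)
    have h_norm: "norm (h \<theta>) = 1" for \<theta> by (simp add: h_def H_norm f_top K_top)
    have h_vertex: "h \<theta> \<in> range p \<longleftrightarrow> cis \<theta> \<in> range p" for \<theta>
      using H_vertex[of "f (K (cis \<theta>))"] H_vertex[of "K (cis \<theta>)"] f_vertex[of "K (cis \<theta>)"]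
      by (simp add: h_def f_top K_top HK')
    have h_inj: "h \<alpha> = h \<beta> \<longleftrightarrow> cis \<alpha> = cis \<beta>" for \<alpha> \<beta>
      unfolding h_def by (metis HK' K_top KH f_top inj inj_onD norm_cis)
    obtain a \<epsilon> where "\<epsilon> = 1 \<or> \<epsilon> = -1" and q: "\<forall>k. h (t k) = p (a + \<epsilon> * k)"
      using dihedral_of_adjacent[of "\<lambda>k. h (t k)", OF adjacent_images[OF h_cont h_norm h_vertex] h_inj]
      by blast
    moreover have "f (P k) = P (a + \<epsilon> * k)" for k
    proof -
      have "f (P k) = K (h (t k))" by (simp add: h_def P_def KH f_top K_top)
      then show ?thesis using q by (simp add: P_def)
    qed
    ultimately show "\<exists>a \<epsilon>. (\<epsilon> = 1 \<or> \<epsilon> = -1) \<and> (\<forall>k. f (P k) = P (a + \<epsilon> * k))" by blast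
  qed
qed

section \<open>Rotations of the subdivided circle\<close>

text \<open>
  The real line wrapped around the circle with period \<open>m\<close>, so that the integers
  become the vertices of the regular \<open>m\<close>-gon.
\<close>

definition turn :: "nat \<Rightarrow> real \<Rightarrow> complex" where
  "turn m s = cis (2 * pi * s / m)"

definition polygon_arc :: "nat \<Rightarrow> int \<Rightarrow> complex set" where
  "polygon_arc m j = turn m ` {of_int j<..<of_int j + 1}"

definition polygon :: "nat \<Rightarrow> complex cw" where
  "polygon m = \<lparr>cw_space = top_of_set (sphere 0 1),
     cw_cells = (\<lambda>d. if d = 0 then range (\<lambda>j::int. {turn m (of_int j)})
                     else if d = 1 then range (polygon_arc m) else {})\<rparr>"

lemma norm_turn [simp]: "norm (turn m s) = 1"
  by (simp add: turn_def)

lemma turn_add: "turn m (s + s') = turn m s * turn m s'"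
  by (simp add: turn_def cis_mult distrib_left add_divide_distrib)

lemma turn_0 [simp]: "turn m 0 = 1"
  by (simp add: turn_def)

lemma turn_eq_iff:
  assumes "0 < m" shows "turn m s = turn m s' \<longleftrightarrow> (\<exists>q::int. s = s' + real m * of_int q)"
proof -
  have "2 * pi * s / m = 2 * pi * s' / m + 2 * pi * of_int q \<longleftrightarrow> s = s' + real m * of_int q" for q
  proof -
    have "2 * pi * s' / m + 2 * pi * of_int q = 2 * pi * (s' + real m * of_int q) / m"
      using assms by (simp add: add_divide_distrib distrib_left)
    then show ?thesis using assms by simp
  qed
  then show ?thesis by (simp add: turn_def cis_eq_cis_iff)
qed

lemma turn_of_int_eq_1_iff:
  assumes "0 < m" shows "turn m (of_int k) = 1 \<longleftrightarrow> int m dvd k"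
proof -
  have "turn m (of_int k) = 1 \<longleftrightarrow> (\<exists>q::int. of_int k = real m * of_int q)"
    using turn_eq_iff[OF assms, of "of_int k" 0] by simp
  also have "\<dots> \<longleftrightarrow> (\<exists>q. k = int m * q)"
    by (metis of_int_eq_iff of_int_mult of_int_of_nat_eq)
  finally show ?thesis by (simp add: dvd_def)
qed

lemma norm_1_imp_turn:
  assumes "0 < m" "norm z = 1" obtains s where "z = turn m s"
proof
  have "z \<noteq> 0" using assms(2) by auto
  then show "z = turn m (m * Arg z / (2 * pi))"
    using assms by (simp add: turn_def cis_Arg sgn_div_norm)
qed

lemma turn_in_polygon_arc_iff:
  assumes "0 < m"
  shows "turn m s \<in> polygon_arc m j \<longleftrightarrow> s \<notin> \<int> \<and> int m dvd \<lfloor>s\<rfloor> - j"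
proof
  assume "turn m s \<in> polygon_arc m j"
  then obtain s' where s'': "of_int j < s'" "s' < of_int j + 1" "turn m s = turn m s'"
    by (auto simp: polygon_arc_def)
  then obtain q where s': "of_int j < s'" "s' < of_int j + 1" "s = s' + real m * of_int q"
    using turn_eq_iff[OF assms] by blast
  have "\<lfloor>s'\<rfloor> = j" using s' by linarith
  have "s = s' + of_int (int m * q)" using s'(3) by simp
  then have "\<lfloor>s\<rfloor> = j + int m * q" using \<open>\<lfloor>s'\<rfloor> = j\<close> by (metis floor_add_int)
  moreover have "s \<notin> \<int>"
  proof
    assume "s \<in> \<int>"
    then obtain k where "s = of_int k" by (rule Ints_cases)
    then have "s = of_int (j + int m * q)" using \<open>\<lfloor>s\<rfloor> = j + int m * q\<close> by simp
    then show False using s' by simp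
  qed
  ultimately show "s \<notin> \<int> \<and> int m dvd \<lfloor>s\<rfloor> - j" by simp
next
  assume s: "s \<notin> \<int> \<and> int m dvd \<lfloor>s\<rfloor> - j"
  then obtain q where q: "\<lfloor>s\<rfloor> - j = int m * q" by auto
  have "s \<noteq> of_int \<lfloor>s\<rfloor>" using s by (metis Ints_of_int)
  then have "of_int \<lfloor>s\<rfloor> < s" "s < of_int \<lfloor>s\<rfloor> + 1" by linarith+
  moreover have "real_of_int \<lfloor>s\<rfloor> = of_int j + real m * of_int q"
    using q by (metis diff_eq_eq add.commute of_int_add of_int_mult of_int_of_nat_eq)
  ultimately have "s - real m * of_int q \<in> {of_int j<..<of_int j + 1}" by simp
  moreover have "turn m s = turn m (s - real m * of_int q)"
    using turn_eq_iff[OF assms] by (metis diff_add_cancel)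
  ultimately show "turn m s \<in> polygon_arc m j" unfolding polygon_arc_def by blast
qed

lemma polygon_arc_subset_sphere: "polygon_arc m j \<subseteq> sphere 0 1"
  by (auto simp: polygon_arc_def)

lemma polygon_arc_cong:
  assumes "0 < m" "int m dvd j - k" shows "polygon_arc m j = polygon_arc m k"
proof -
  have "z \<in> polygon_arc m j \<longleftrightarrow> z \<in> polygon_arc m k" if z: "norm z = 1" for z
  proof -
    obtain s where "z = turn m s" using norm_1_imp_turn[OF assms(1) z] .
    moreover have "int m dvd \<lfloor>s\<rfloor> - j \<longleftrightarrow> int m dvd \<lfloor>s\<rfloor> - k"
      using assms(2) dvd_add_left_iff[of "int m" "j - k" "\<lfloor>s\<rfloor> - j"] by simp
    ultimately show ?thesis using turn_in_polygon_arc_iff[OF assms(1)] by simp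
  qed
  then show ?thesis using polygon_arc_subset_sphere by fastforce
qed

lemma turn_of_int_cong:
  assumes "0 < m" "int m dvd j - k" shows "turn m (of_int j) = turn m (of_int k)"
  using assms turn_of_int_eq_1_iff[OF assms(1), of "j - k"] turn_add[of m "of_int (j - k)" "of_int k"]
  by simp

lemma polygon_arc_disjoint:
  assumes "0 < m" "polygon_arc m j \<inter> polygon_arc m k \<noteq> {}"
  shows "polygon_arc m j = polygon_arc m k"
proof -
  obtain s where "turn m s \<in> polygon_arc m j" "turn m s \<in> polygon_arc m k"
    using assms(2) by (auto simp: polygon_arc_def)
  then have "int m dvd \<lfloor>s\<rfloor> - j" "int m dvd \<lfloor>s\<rfloor> - k"
    using turn_in_polygon_arc_iff[OF assms(1)] by auto
  then have "int m dvd (\<lfloor>s\<rfloor> - k) - (\<lfloor>s\<rfloor> - j)" by (rule dvd_diff[rotated])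
  then show ?thesis using polygon_arc_cong[OF assms(1)] by simp
qed

lemma polygon_vertex_not_in_arc:
  assumes "0 < m" shows "turn m (of_int j) \<notin> polygon_arc m k"
  using turn_in_polygon_arc_iff[OF assms] by simp

lemma polygon_arc_rotate:
  "(\<lambda>z. turn m (of_int k) * z) ` polygon_arc m j = polygon_arc m (k + j)"
proof -
  have "{of_int (k + j)<..<of_int (k + j) + 1} = (\<lambda>s. of_int k + s) ` {of_int j<..<of_int j + (1::real)}"
    by (auto intro!: image_eqI[of _ _ "_ - of_int k"])
  then show ?thesis by (simp only: polygon_arc_def image_image turn_add)
qed

lemma polygon_space [simp]: "cw_space (polygon m) = top_of_set (sphere 0 1)"
  by (simp add: polygon_def)

lemma all_cells_polygon:
  "all_cells (polygon m) = range (\<lambda>j::int. {turn m (of_int j)}) \<union> range (polygon_arc m)"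
  by (auto simp: all_cells_def polygon_def split: if_splits)

lemma finite_all_cells_polygon:
  assumes "0 < m" shows "finite (all_cells (polygon m))"
proof -
  \<comment> \<open>both kinds of cells depend only on the index modulo \<open>m\<close>\<close>
  have rep: "range F \<subseteq> F ` {0..<int m}"
    if F: "\<And>j k. int m dvd j - k \<Longrightarrow> F j = F k" for F :: "int \<Rightarrow> complex set"
  proof
    fix e assume "e \<in> range F"
    then obtain j where "e = F j" by blast
    also have "F j = F (j mod int m)" by (rule F) (simp add: mod_eq_dvd_iff[symmetric])
    finally show "e \<in> F ` {0..<int m}" using assms by simp
  qed
  have "finite (range F)"
    if F: "\<And>j k. int m dvd j - k \<Longrightarrow> F j = F k" for F :: "int \<Rightarrow> complex set"
    using rep[OF F] by (rule finite_subset) auto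
  from this[of "\<lambda>j. {turn m (of_int j)}"] this[of "polygon_arc m"] show ?thesis
    using turn_of_int_cong[OF assms] polygon_arc_cong[OF assms] by (auto simp: all_cells_polygon)
qed

lemma characteristic_map_polygon_vertex:
  "characteristic_map (polygon m) 0 {turn m (of_int j)} (\<lambda>_. turn m (of_int j))"
proof -
  have ball: "open_unit_ball 0 = {\<lambda>_. 0}" and sphere: "unit_sphere 0 = {}"
    by (auto simp: open_unit_ball_def unit_sphere_def topspace_Euclidean_space)
  have "homeomorphic_maps (subtopology (Euclidean_space 0) {\<lambda>_. 0})
      (top_of_set {turn m (of_int j)}) (\<lambda>_. turn m (of_int j)) (\<lambda>_ _. 0)"
    by (auto simp: homeomorphic_maps_def topspace_Euclidean_space)
  then show ?thesis
    by (auto simp: characteristic_map_def ball sphere homeomorphic_map_maps subtopology_subtopology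
        intro!: exI[of _ "{}"])
qed

text \<open>
  The interval \<open>[-1,1]\<close> is stretched onto the closed arc. Measured from the midpoint \<open>c\<close> of the arc, the
  angles on the open arc are less than \<open>\<pi>/m \<le> \<pi>/2\<close> in size, so the principal argument of \<open>z/c\<close> is continuous
  there and gives the inverse. This is where \<open>m \<ge> 2\<close> enters.
\<close>

lemma characteristic_map_polygon_arc:
  assumes m: "2 \<le> m"
  shows "characteristic_map (polygon m) 1 (polygon_arc m j) (\<lambda>x. turn m (of_int j + (1 + x 0) / 2))"
    (is "characteristic_map _ _ ?e ?f")
proof -
  \<comment> \<open>keeps the dimension in the form \<open>1\<close>, in which it occurs in the goal\<close>
  note One_nat_def [simp del]
  have coord: "continuous_map (subtopology (Euclidean_space 1) S) euclideanreal (\<lambda>x. x 0)" for S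
    unfolding Euclidean_space_def
    by (intro continuous_map_from_subtopology continuous_map_product_projection) simp
  have f_cont: "continuous_map (subtopology (Euclidean_space 1) S) (top_of_set (sphere 0 1)) ?f" for S
  proof -
    have "continuous_on UNIV (\<lambda>y. turn m (of_int j + (1 + y) / 2))"
      unfolding turn_def by (intro continuous_intros) (use m in auto)
    then have "continuous_map euclideanreal euclidean (\<lambda>y. turn m (of_int j + (1 + y) / 2))"
      by simp
    from continuous_map_compose[OF coord this] show ?thesis
      by (simp add: continuous_map_in_subtopology o_def)
  qed
  define c where "c = turn m (of_int j + 1 / 2)"
  \<comment> \<open>the angle from \<open>c\<close> is \<open>\<pi>x/m\<close>, where \<open>x\<close> is the coordinate in \<open>[-1,1]\<close>\<close>
  define g where "g z = (\<lambda>i::nat. if i < 1 then Arg (z / c) * m / pi else 0)" for z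
  have f_eq: "?f x / c = cis (pi * x 0 / m)" for x
  proof -
    have "?f x = c * turn m (x 0 / 2)"
      unfolding c_def by (simp add: turn_add[symmetric] add_divide_distrib add.assoc)
    moreover have "c \<noteq> 0" unfolding c_def by (metis norm_turn norm_zero zero_neq_one)
    ultimately show ?thesis by (simp add: turn_def)
  qed
  have angle: "\<bar>pi * y / m\<bar> < pi / 2" if "\<bar>y\<bar> < 1" for y
  proof -
    have "\<bar>pi * y / m\<bar> = pi * \<bar>y\<bar> / m" by (simp add: abs_mult)
    also have "\<dots> \<le> pi * \<bar>y\<bar> / 2" using m by (intro divide_left_mono) auto
    also have "\<dots> < pi / 2" using that by simp
    finally show ?thesis .
  qed
  have ball: "open_unit_ball 1 = {x. (\<forall>i\<ge>1. x i = 0) \<and> \<bar>x 0\<bar> < 1}"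
    by (auto simp: open_unit_ball_def topspace_Euclidean_space abs_square_less_1 One_nat_def)
  have gf: "g (?f x) = x" if x: "x \<in> open_unit_ball 1" for x
  proof -
    have "\<bar>x 0\<bar> < 1" using x by (simp add: ball)
    then have "- pi < pi * x 0 / m" "pi * x 0 / m \<le> pi"
      using angle[of "x 0"] pi_gt_zero by linarith+
    then have "Arg (?f x / c) = pi * x 0 / m"
      unfolding f_eq by (intro cis_Arg_unique) auto
    then show ?thesis using x m by (auto simp: g_def ball fun_eq_iff not_less)
  qed
  have f_image: "?f ` open_unit_ball 1 = ?e"
  proof
    show "?f ` open_unit_ball 1 \<subseteq> ?e" by (auto simp: ball polygon_arc_def intro!: imageI)
    show "?e \<subseteq> ?f ` open_unit_ball 1"
    proof
      fix z assume "z \<in> ?e"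
      then obtain s where s: "of_int j < s" "s < of_int j + 1" "z = turn m s"
        by (auto simp: polygon_arc_def)
      define x where "x = (\<lambda>i::nat. if i = 0 then 2 * (s - of_int j) - 1 else 0)"
      have "x \<in> open_unit_ball 1" using s by (auto simp: ball x_def)
      moreover have "of_int j + (1 + x 0) / 2 = s" by (simp add: x_def field_simps)
      then have "z = ?f x" using s(3) by simp
      ultimately show "z \<in> ?f ` open_unit_ball 1" by blast
    qed
  qed
  have g_cont: "continuous_map (top_of_set ?e) (Euclidean_space 1) g"
  proof -
    have pos: "z / c \<notin> \<real>\<^sub>\<le>\<^sub>0" if z: "z \<in> ?e" for z
    proof -
      obtain x where x: "x \<in> open_unit_ball 1" "z = ?f x" using z f_image by blast
      have "\<bar>x 0\<bar> < 1" using x(1) by (simp add: ball)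
      then have "- (pi / 2) < pi * x 0 / m" "pi * x 0 / m < pi / 2"
        using angle[of "x 0"] by linarith+
      then have "0 < cos (pi * x 0 / m)" by (rule cos_gt_zero_pi)
      then have "0 < Re (z / c)" by (simp add: x(2) f_eq)
      then show ?thesis by (auto simp: complex_nonpos_Reals_iff)
    qed
    have "continuous_on ?e (\<lambda>z. Arg (z / c) * m / pi)"
      using pos by (intro continuous_intros) (auto simp: c_def)
    then have "continuous_map (top_of_set ?e) euclideanreal (\<lambda>z. Arg (z / c) * m / pi)"
      by simp
    then show ?thesis
      unfolding g_def using continuous_map_componentwise_Euclidean_space[of "top_of_set ?e" 1
          "\<lambda>z i. Arg (z / c) * m / pi"] by simp
  qed
  have inverse: "g z \<in> open_unit_ball 1" "?f (g z) = z" if z: "z \<in> ?e" for z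
  proof -
    obtain x where "x \<in> open_unit_ball 1" "z = ?f x" using z f_image by blast
    then show "g z \<in> open_unit_ball 1" "?f (g z) = z" using gf by simp_all
  qed
  have "homeomorphic_maps (subtopology (Euclidean_space 1) (open_unit_ball 1)) (top_of_set ?e) ?f g"
    unfolding homeomorphic_maps_def
  proof (intro conjI ballI)
    show "continuous_map (subtopology (Euclidean_space 1) (open_unit_ball 1)) (top_of_set ?e) ?f"
      using f_cont[of "open_unit_ball 1"] f_image by (auto simp: continuous_map_in_subtopology)
    show "continuous_map (top_of_set ?e) (subtopology (Euclidean_space 1) (open_unit_ball 1)) g"
      using g_cont inverse(1) by (auto simp: continuous_map_in_subtopology)
  qed (use gf inverse(2) in auto)
  then have "homeomorphic_map (subtopology (Euclidean_space 1) (open_unit_ball 1))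
      (subtopology (cw_space (polygon m)) ?e) ?f"
    using polygon_arc_subset_sphere[of m j]
    by (auto simp: homeomorphic_map_maps subtopology_subtopology inf_absorb2)
  moreover have "?f ` unit_sphere 1 \<subseteq> \<Union>{{turn m (of_int j)}, {turn m (of_int (j + 1))}}"
  proof -
    have "x 0 = 1 \<or> x 0 = -1" if "x \<in> unit_sphere 1" for x
      using that by (simp add: unit_sphere_def power2_eq_1_iff One_nat_def)
    then show ?thesis by (force simp: add.commute)
  qed
  moreover have "{{turn m (of_int j)}, {turn m (of_int (j + 1))}} \<subseteq> (\<Union>d<1. cw_cells (polygon m) d)"
    by (auto simp: polygon_def simp del: of_int_add)
  ultimately show ?thesis
    unfolding characteristic_map_def using f_cont by (metis finite.emptyI finite.insertI polygon_space)
qed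

text \<open>
  With finitely many cells the weak topology condition is automatic: a set is the finite union
  of its traces on the closures of the cells.
\<close>

lemma polygon_in_P1:
  assumes m: "2 \<le> m" shows "polygon m \<in> P1"
proof -
  have m0: "0 < m" using m by simp
  have cells: "\<Union>(all_cells (polygon m)) = sphere 0 1"
  proof
    show "\<Union>(all_cells (polygon m)) \<subseteq> sphere 0 1"
      using polygon_arc_subset_sphere by (auto simp: all_cells_polygon)
    show "sphere 0 1 \<subseteq> \<Union>(all_cells (polygon m))"
    proof
      fix z :: complex assume "z \<in> sphere 0 1"
      then obtain s where s: "z = turn m s" using norm_1_imp_turn[OF m0, of z] by auto
      show "z \<in> \<Union>(all_cells (polygon m))"
      proof (cases "s \<in> \<int>")
        case True
        then show ?thesis using s by (auto simp: all_cells_polygon elim!: Ints_cases)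
      next
        case False
        then have "z \<in> polygon_arc m \<lfloor>s\<rfloor>" using s turn_in_polygon_arc_iff[OF m0] by simp
        then show ?thesis by (auto simp: all_cells_polygon)
      qed
    qed
  qed
  have disjoint: "d \<inter> e = {}"
    if "d \<in> cw_cells (polygon m) k" "e \<in> cw_cells (polygon m) l" "(k, d) \<noteq> (l, e)" for k l d e
    using that polygon_arc_disjoint[OF m0] polygon_vertex_not_in_arc[OF m0]
    by (auto simp: polygon_def split: if_splits)
  have char: "\<exists>f. characteristic_map (polygon m) k e f" if e: "e \<in> cw_cells (polygon m) k" for k e
  proof -
    consider j where "k = 0" "e = {turn m (of_int j)}" | j where "k = 1" "e = polygon_arc m j"
      using e by (auto simp: polygon_def split: if_splits)
    then show ?thesis
      using characteristic_map_polygon_vertex characteristic_map_polygon_arc[OF m] by cases blast+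
  qed
  have weak: "closedin (top_of_set (sphere 0 1)) A"
    if A: "A \<subseteq> sphere 0 1"
      and cl: "\<forall>e\<in>all_cells (polygon m). closedin (top_of_set (sphere 0 1)) (A \<inter> top_of_set (sphere 0 1) closure_of e)"
    for A :: "complex set"
  proof -
    have in_closure: "e \<subseteq> top_of_set (sphere 0 1) closure_of e" if "e \<in> all_cells (polygon m)" for e
      using that cells by (intro closure_of_subset) auto
    have "A = (\<Union>e\<in>all_cells (polygon m). A \<inter> top_of_set (sphere 0 1) closure_of e)"
    proof (intro equalityI subsetI)
      fix x assume "x \<in> A"
      then obtain e where "e \<in> all_cells (polygon m)" "x \<in> e" using A cells by blast
      then show "x \<in> (\<Union>e\<in>all_cells (polygon m). A \<inter> top_of_set (sphere 0 1) closure_of e)"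
        using \<open>x \<in> A\<close> in_closure by blast
    qed auto
    moreover have "closedin (top_of_set (sphere 0 1))
        (\<Union>e\<in>all_cells (polygon m). A \<inter> top_of_set (sphere 0 1) closure_of e)"
      using cl finite_all_cells_polygon[OF m0] by (intro closedin_Union) auto
    ultimately show ?thesis by simp
  qed
  have "cw_complex (polygon m)"
    unfolding cw_complex_def
    using cells disjoint char weak by (simp add: Hausdorff_space_subtopology)
  then show ?thesis by (simp add: P1_def homeomorphic_space_refl)
qed

text \<open>
  Restricted to the circle, since group actions are valued in the extensional bijections of the
  space.
\<close>

definition rotation_action :: "nat \<Rightarrow> ('a \<Rightarrow> int) \<Rightarrow> 'a \<Rightarrow> complex \<Rightarrow> complex" where
  "rotation_action m r g = (\<lambda>z\<in>sphere 0 1. turn m (of_int (r g)) * z)"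

lemma homeomorphic_map_rotation: "homeomorphic_map (top_of_set (sphere 0 1)) (top_of_set (sphere 0 1)) (rotation_action m r g)"
proof -
  let ?S = "top_of_set (sphere (0::complex) 1)"
  let ?c = "turn m (of_int (r g))"
  have c: "?c * turn m (- of_int (r g)) = 1" "turn m (- of_int (r g)) * ?c = 1"
    by (simp_all add: turn_add[symmetric])
  have "homeomorphic_maps ?S ?S (\<lambda>z. ?c * z) (\<lambda>z. turn m (- of_int (r g)) * z)"
    unfolding homeomorphic_maps_def
    by (auto simp: continuous_map_in_subtopology norm_mult mult.assoc[symmetric] c intro!: continuous_intros)
  then have "homeomorphic_map ?S ?S (\<lambda>z. ?c * z)" by (auto simp: homeomorphic_map_maps)
  then show ?thesis
    by (rule homeomorphic_map_eq) (simp add: rotation_action_def)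
qed

text \<open>
  The rotation by \<open>k\<close> steps takes the \<open>j\<close>-th arc to the \<open>(k + j)\<close>-th one. Distinct arcs are disjoint, so
  if it maps some arc to itself, then \<open>m\<close> divides \<open>k\<close> and the rotation is trivial. A rotation that
  fixes a point of the circle is trivial as well, and so all isotropy groups are equal.
\<close>

lemma cellular_rotation_action:
  fixes r :: "'a \<Rightarrow> int" and G (structure)
  assumes G: "group G" and m: "0 < m"
    and r: "\<And>x y. x \<in> carrier G \<Longrightarrow> y \<in> carrier G \<Longrightarrow> int m dvd r (x \<otimes> y) - (r x + r y)"
  shows "cellular_action G (polygon m) (rotation_action m r)"
    and "z \<in> sphere 0 1 \<Longrightarrow> stabilizer G (rotation_action m r) z = {x \<in> carrier G. int m dvd r x}"
proof -
  let ?S = "sphere (0::complex) 1"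
  let ?\<phi> = "rotation_action m r"
  have \<phi>: "?\<phi> g z = turn m (of_int (r g)) * z" if "z \<in> ?S" for g z
    using that by (simp add: rotation_action_def)
  have Bij: "?\<phi> g \<in> Bij ?S" for g
  proof -
    have "bij_betw (?\<phi> g) ?S ?S"
      using homeomorphic_imp_surjective_map[OF homeomorphic_map_rotation[of m r g]]
        homeomorphic_imp_injective_map[OF homeomorphic_map_rotation[of m r g]]
      by (simp add: bij_betw_def)
    then show ?thesis by (simp add: Bij_def rotation_action_def)
  qed
  have "?\<phi> (x \<otimes> y) = compose ?S (?\<phi> x) (?\<phi> y)" if xy: "x \<in> carrier G" "y \<in> carrier G" for x y
  proof -
    have "turn m (of_int (r (x \<otimes> y))) = turn m (of_int (r x + r y))"
      by (rule turn_of_int_cong[OF m r[OF xy]])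
    then show ?thesis
      by (auto simp: rotation_action_def compose_def fun_eq_iff turn_add norm_mult)
  qed
  then have act: "group_action G ?S ?\<phi>"
    using G Bij group_BijGroup
    by (auto simp: group_action_def group_hom_def group_hom_axioms_def hom_def BijGroup_def)
  have trivial: "?\<phi> g z = z \<longleftrightarrow> int m dvd r g" if "z \<in> ?S" for g z
  proof -
    have "z \<noteq> 0" using that by auto
    then show ?thesis using \<phi>[OF that] turn_of_int_eq_1_iff[OF m] by simp
  qed
  have image_vertex: "?\<phi> g ` {turn m (of_int j)} = {turn m (of_int (r g + j))}" for g j
    by (simp add: \<phi> turn_add)
  have image_arc: "?\<phi> g ` polygon_arc m j = polygon_arc m (r g + j)" for g j
    unfolding polygon_arc_rotate[symmetric]
    using polygon_arc_subset_sphere[of m j] by (intro image_cong refl \<phi>) blast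
  have "\<forall>x\<in>e. ?\<phi> g x = x" if e: "e \<in> all_cells (polygon m)" and inv: "?\<phi> g ` e = e" for g e
  proof -
    have sub: "e \<subseteq> ?S" using e polygon_arc_subset_sphere by (auto simp: all_cells_polygon)
    from e consider j where "e = {turn m (of_int j)}" | j where "e = polygon_arc m j"
      by (auto simp: all_cells_polygon)
    then show ?thesis
    proof cases
      case 1
      then show ?thesis using inv by auto
    next
      case 2
      then have "polygon_arc m (r g + j) = polygon_arc m j" using inv image_arc by simp
      moreover have "turn m (of_int j + 1 / 2) \<in> polygon_arc m j"
        unfolding polygon_arc_def by (intro imageI) simp
      moreover have "\<lfloor>of_int j + 1 / 2 :: real\<rfloor> = j" by linarith
      ultimately have "int m dvd j - (r g + j)" using turn_in_polygon_arc_iff[OF m] by metis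
      then have "int m dvd r g" by simp
      then show ?thesis using trivial sub by blast
    qed
  qed
  moreover have "?\<phi> g ` e \<in> all_cells (polygon m)" if "e \<in> all_cells (polygon m)" for g e
  proof -
    from that consider j where "e = {turn m (of_int j)}" | j where "e = polygon_arc m j"
      by (auto simp: all_cells_polygon)
    then show ?thesis
      by cases (simp_all only: image_vertex image_arc all_cells_polygon, blast+)
  qed
  ultimately show "cellular_action G (polygon m) ?\<phi>"
    using act homeomorphic_map_rotation[of m r] by (simp add: cellular_action_def)
  show "z \<in> sphere 0 1 \<Longrightarrow> stabilizer G ?\<phi> z = {x \<in> carrier G. int m dvd r x}"
    using trivial by (auto simp: stabilizer_def)
qed

section \<open>The class generated by the circle\<close>

lemma subgroup_of_finite_solvable:
  assumes G: "group G" "finite (carrier G)" "solvable G" and N: "subgroup N G"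
  shows "group (G\<lparr>carrier := N\<rparr>)" "finite N" "solvable (G\<lparr>carrier := N\<rparr>)"
proof -
  interpret group G by (rule G)
  interpret incl: group_hom "G\<lparr>carrier := N\<rparr>" G "\<lambda>x. x"
    using canonical_inj_is_hom[OF N] by (simp add: id_def)
  show "group (G\<lparr>carrier := N\<rparr>)" by (rule incl.G.is_group)
  show "finite N" using G(2) subgroup.subset[OF N] finite_subset by blast
  show "solvable (G\<lparr>carrier := N\<rparr>)" using G(3) by (intro incl.inj_hom_imp_solvable) auto
qed

lemma finite_solvable_of_circle_action:
  assumes X: "X \<in> P1" and act: "cellular_action G X \<phi>"
    and stab: "\<And>x. x \<in> topspace (cw_space X) \<Longrightarrow>
      finite (stabilizer G \<phi> x) \<and> solvable (G\<lparr>carrier := stabilizer G \<phi> x\<rparr>)"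
  shows "finite (carrier G) \<and> solvable G"
proof -
  have cw: "cw_complex X" and circle: "cw_space X homeomorphic_space top_of_set (sphere (0::complex) 1)"
    using X by (auto simp: P1_def)
  have gact: "group_action G (topspace (cw_space X)) \<phi>"
    using act by (simp add: cellular_action_def)
  interpret group_action G "topspace (cw_space X)" \<phi> by (rule gact)
  interpret group G using group_hom group_hom.axioms(1) by blast
  have "compact_space (cw_space X)"
    using homeomorphic_compact_space[OF circle] by (simp add: compact_space_subtopology)
  then have fin: "finite (vertices X)" by (rule vertices_finite[OF cw])
  have "topspace (top_of_set (sphere (0::complex) 1)) \<noteq> {}" by simp
  then have "top_of_set (sphere (0::complex) 1) \<noteq> trivial_topology"
    by (metis topspace_discrete_topology)
  then have "topspace (cw_space X) \<noteq> {}"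
    using homeomorphic_empty_space[OF circle] by simp
  then have ne: "vertices X \<noteq> {}" by (rule vertices_nonempty[OF cw])
  have sub: "vertices X \<subseteq> topspace (cw_space X)"
    using cell_subset_topspace[OF cw] by (auto simp: vertices_def)
  obtain P :: "int \<Rightarrow> complex" where P: "\<And>k. P k \<in> vertices X"
    and dihedral: "\<And>f. continuous_map (cw_space X) (cw_space X) f \<Longrightarrow>
      inj_on f (topspace (cw_space X)) \<Longrightarrow> f ` vertices X \<subseteq> vertices X \<Longrightarrow>
      \<exists>a \<epsilon>. (\<epsilon> = 1 \<or> \<epsilon> = -1) \<and> (\<forall>k. f (P k) = P (a + \<epsilon> * k))"
    using homeomorphic_circle_dihedral_enumeration[OF circle fin ne sub] by blast
  have P_top: "P k \<in> topspace (cw_space X)" for k using P sub by blast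
  have "(derived G ^^ 2) (carrier G) \<subseteq> stabilizer G \<phi> (P 0)"
  proof (rule second_derived_subset_stabilizer[OF gact P_top])
    fix g assume g: "g \<in> carrier G"
    have "homeomorphic_map (cw_space X) (cw_space X) (\<phi> g)"
      using act g by (simp add: cellular_action_def)
    then show "\<exists>a \<epsilon>. (\<epsilon> = 1 \<or> \<epsilon> = -1) \<and> (\<forall>k. \<phi> g (P k) = P (a + \<epsilon> * k))"
      using cellular_action_vertices[OF cw act g] inj_prop[OF g]
      by (intro dihedral) (auto dest: homeomorphic_imp_continuous_map)
  qed
  then have "solvable G"
    using solvable_of_derived_subset_solvable[OF stabilizer_subgroup[OF P_top]] stab P_top by blast
  moreover have "finite (carrier G)"
    using finite_group_of_finite_orbit[OF gact P_top fin] cellular_action_vertices[OF cw act _ P]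
      stab P_top by blast
  ultimately show ?thesis by blast
qed

text \<open>
  The derived series of a group that equals its commutator subgroup is constant, so a solvable
  group of this kind is trivial. Any other finite solvable group acts on a polygon through a
  cyclic quotient, and the isotropy groups equal the kernel.
\<close>

lemma finite_solvable_in_N_cell:
  fixes G :: "'a monoid"
  assumes "group G" "finite (carrier G)" "solvable G"
  shows "G \<in> N_cell P1"
  using assms
proof (induction "card (carrier G)" arbitrary: G rule: less_induct)
  case less
  interpret group G by (rule less.prems)
  show ?case
  proof (cases "derived G (carrier G) = carrier G")
    case True
    then have "(derived G ^^ n) (carrier G) = carrier G" for n by (induction n) auto
    then have "carrier G = {\<one>\<^bsub>G\<^esub>}"
      using less.prems(3) solvable_iff_trivial_derived_seq by auto
    then show ?thesis using less.prems(1) by (intro N_cell.trivial) (simp add: trivial_group_def)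
  next
    case False
    obtain N m and r :: "'a \<Rightarrow> int" where N: "subgroup N G" "N \<subset> carrier G" and m: "2 \<le> m"
      and r: "\<And>x y. x \<in> carrier G \<Longrightarrow> y \<in> carrier G \<Longrightarrow> int m dvd r (x \<otimes>\<^bsub>G\<^esub> y) - (r x + r y)"
      and r_N: "\<And>x. x \<in> carrier G \<Longrightarrow> int m dvd r x \<longleftrightarrow> x \<in> N"
      using cyclic_quotient_of_imperfect[OF less.prems(2) False] by blast
    note N_solvable = subgroup_of_finite_solvable[OF less.prems N(1)]
    have "card N < card (carrier G)" using N(2) less.prems(2) by (rule psubset_card_mono[rotated])
    then have "G\<lparr>carrier := N\<rparr> \<in> N_cell P1"
      using N_solvable by (intro less.hyps) auto
    moreover have m0: "0 < m" using m by simp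
    moreover have "stabilizer G (rotation_action m r) x = N"
      if "x \<in> topspace (cw_space (polygon m))" for x
      using cellular_rotation_action(2)[OF less.prems(1) m0 r] that r_N N(2) by auto
    ultimately show ?thesis
      using cellular_rotation_action(1)[OF less.prems(1) m0 r]
      by (intro N_cell.action[OF less.prems(1) polygon_in_P1[OF m]]) auto
  qed
qed

theorem proposition3p1:
  shows "(N_cell P1 :: 'a monoid set) = {G. group G \<and> finite (carrier G) \<and> solvable G}"
proof (intro equalityI subsetI)
  fix G :: "'a monoid" assume "G \<in> N_cell P1"
  then show "G \<in> {G. group G \<and> finite (carrier G) \<and> solvable G}"
  proof induction
    case (trivial G)
    then have "carrier G = {\<one>\<^bsub>G\<^esub>}" "group G" by (simp_all add: trivial_group_def)
    then have "solvable G" by (simp add: solvable_def solvable_seq.unity)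
    then show ?case using \<open>carrier G = {\<one>\<^bsub>G\<^esub>}\<close> \<open>group G\<close> by simp
  next
    case (action G X \<phi>)
    then show ?case using finite_solvable_of_circle_action[OF action(2,3)] by simp
  qed
next
  fix G :: "'a monoid" assume "G \<in> {G. group G \<and> finite (carrier G) \<and> solvable G}"
  then show "G \<in> N_cell P1" using finite_solvable_in_N_cell by blast
qed

end
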